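(* Let $0<H<1$, $0<K\leq 1$ and $T>0$. Let $W^{H,K}$ be a bifractional Brownian motion with parameters $H,K$, let $W^{HK}$ be a fractional Brownian motion with Hurst index $HK$, and put $Y^{(1)}_t=2^{(1-K)/2}W^{HK}(t)$ and $Y^{(2)}_t=2^{-K/2}W^{HK}(t)$ for $0\leq t\leq T$. Let $m:[0,T]\to\mathbb{R}$ be any continuous function. Then the following inequalities hold, provided that the expectations appearing in them exist. (i) $$E\Big[\sup_{0\leq t\leq T}(W_t^{H,K}+m(t))\Big]\leq E\Big[\sup_{0\leq t\leq T}(Y_t^{(1)}+m(t))\Big]$$ and $$E\Big[\sup_{0\leq t\leq T}(W_t^{H,K}+m(t))\Big]\geq E\Big[\sup_{0\leq t\leq T}(Y_t^{(2)}+m(t))\Big].$$ (ii) For any constant $c\in\mathbb{R}$ and any fixed $s\in[0,T]$, $$E\Big[\sup_{0\leq t\leq T}\{W_t^{H,K}+m(t)-W_s^{H,K},c\}\Big]\leq E\Big[\sup_{0\leq t\leq T}\{Y_t^{(1)}+m(t)-Y_s^{(1)},c\}\Big]$$ and $$E\Big[\sup_{0\leq t\leq T}\{W_t^{H,K}+m(t)-W_s^{H,K},c\}\Big]\geq E\Big[\sup_{0\leq t\leq T}\{Y_t^{(2)}+m(t)-Y_s^{(2)},c\}\Big].$$ (iii) For any non-decreasing convex function $g:\mathbb{R}\to\mathbb{R}$ and any fixed $s\in[0,T]$, $$E\Big[g\Big(\sup_{0\leq t\leq T}(W_t^{H,K}+m(t)-W_s^{H,K})\Big)\Big]\leq E\Big[g\Big(\sup_{0\leq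 t\leq T}(Y_t^{(1)}+m(t)-Y_s^{(1)})\Big)\Big]$$ and $$E\Big[g\Big(\sup_{0\leq t\leq T}(W_t^{H,K}+m(t)-W_s^{H,K})\Big)\Big]\geq E\Big[g\Big(\sup_{0\leq t\leq T}(Y_t^{(2)}+m(t)-Y_s^{(2)})\Big)\Big].$$
   Context: A bifractional Brownian motion with parameters $H\in(0,1)$, $K\in(0,1]$ is a centered Gaussian process $\{W_t^{H,K},t\geq 0\}$ with covariance function $$C_H(s,t)=\frac{1}{2^K}\big[(t^{2H}+s^{2H})^K-|s-t|^{2HK}\big].$$ A fractional Brownian motion with Hurst index $h\in(0,1)$ is a centered Gaussian process with covariance function $\frac12(t^{2h}+s^{2h}-|t-s|^{2h})$; here $h=HK$. All processes are assumed to have almost surely continuous sample paths on $[0,T]$. For a process $Z$ and a constant $c$, $\sup_{0\leq t\leq T}\{Z_t,c\}$ denotes $\max\{\sup_{0\leq t\leq T}Z_t,\,c\}$. *)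

theory Defs
  imports "HOL-Probability.Probability"
begin

text \<open>
  Point masses are admitted as Gaussian laws of variance zero; this is needed because the
  processes below vanish almost surely at time zero.
\<close>

definition gaussian_rv :: "'a measure \<Rightarrow> ('a \<Rightarrow> real) \<Rightarrow> bool" where
  "gaussian_rv M X \<longleftrightarrow> X \<in> borel_measurable M \<and>
     ((\<exists>\<mu> \<sigma>. 0 < \<sigma> \<and> distributed M lborel X (normal_density \<mu> \<sigma>)) \<or>
      (\<exists>\<mu>. AE \<omega> in M. X \<omega> = \<mu>))"

definition gaussian_process :: "'a measure \<Rightarrow> 'i set \<Rightarrow> ('i \<Rightarrow> 'a \<Rightarrow> real) \<Rightarrow> bool" where
  "gaussian_process M I X \<longleftrightarrow> prob_space M \<and> (\<forall>t\<in>I. X t \<in> borel_measurable M) \<and>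
     (\<forall>J a. finite J \<and> J \<subseteq> I \<longrightarrow> gaussian_rv M (\<lambda>\<omega>. \<Sum>t\<in>J. a t * X t \<omega>))"

definition covariance :: "'a measure \<Rightarrow> ('a \<Rightarrow> real) \<Rightarrow> ('a \<Rightarrow> real) \<Rightarrow> real" where
  "covariance M X Y =
     integral\<^sup>L M (\<lambda>\<omega>. (X \<omega> - integral\<^sup>L M X) * (Y \<omega> - integral\<^sup>L M Y))"

definition centered_gaussian_process ::
  "'a measure \<Rightarrow> 'i set \<Rightarrow> ('i \<Rightarrow> 'i \<Rightarrow> real) \<Rightarrow> ('i \<Rightarrow> 'a \<Rightarrow> real) \<Rightarrow> bool" where
  "centered_gaussian_process M I C X \<longleftrightarrow> gaussian_process M I X \<and>
     (\<forall>t\<in>I. integral\<^sup>L M (X t) = 0) \<and>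
     (\<forall>s\<in>I. \<forall>t\<in>I. covariance M (X s) (X t) = C s t)"

definition bifractional_bm ::
  "'a measure \<Rightarrow> real \<Rightarrow> real \<Rightarrow> (real \<Rightarrow> 'a \<Rightarrow> real) \<Rightarrow> bool" where
  "bifractional_bm M H K W \<longleftrightarrow> 0 < H \<and> H < 1 \<and> 0 < K \<and> K \<le> 1 \<and>
     centered_gaussian_process M {0..}
       (\<lambda>s t. 1 / 2 powr K *
          ((t powr (2 * H) + s powr (2 * H)) powr K - \<bar>s - t\<bar> powr (2 * H * K))) W"

definition fractional_bm :: "'a measure \<Rightarrow> real \<Rightarrow> (real \<Rightarrow> 'a \<Rightarrow> real) \<Rightarrow> bool" where
  "fractional_bm M h B \<longleftrightarrow> 0 < h \<and> h < 1 \<and>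
     centered_gaussian_process M {0..}
       (\<lambda>s t. 1 / 2 * (t powr (2 * h) + s powr (2 * h) - \<bar>t - s\<bar> powr (2 * h))) B"

definition continuous_paths :: "'a measure \<Rightarrow> real set \<Rightarrow> (real \<Rightarrow> 'a \<Rightarrow> real) \<Rightarrow> bool" where
  "continuous_paths M S X \<longleftrightarrow> (AE \<omega> in M. continuous_on S (\<lambda>t. X t \<omega>))"

text \<open>
  Paths are continuous only almost surely, so a supremum over an interval is in general
  measurable only with respect to the completed probability space. Expectations are
  therefore taken there; for measurable functions this agrees with integrability and
  the integral on the original space. Expectations that exist are understood to be finite.
\<close>

definition expectation_exists :: "'a measure \<Rightarrow> ('a \<Rightarrow> real) \<Rightarrow> bool" where
  "expectation_exists M X \<longleftrightarrow> integrable (completion M) X"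

definition expect :: "'a measure \<Rightarrow> ('a \<Rightarrow> real) \<Rightarrow> real" where
  "expect M X = integral\<^sup>L (completion M) X"

end

theory Submission
  imports Defs
begin

text \<open>
  The increments satisfy \<open>E (Y2 s - Y2 t)\<^sup>2 \<le> E (W s - W t)\<^sup>2 \<le> E (Y1 s - Y1 t)\<^sup>2\<close>, so the
  inequalities are instances of a Sudakov--Fernique comparison with drift. For finitely many times and
  the plain maximum, replace the maximum by log-sum-exp and differentiate its expectation along
  \<open>cos \<theta> X + sin \<theta> Y\<close> with \<open>X\<close>, \<open>Y\<close> independent: Gaussian integration by parts
  expresses the derivative through the differences of the increment variances. Truncating
  \<open>Max (X t + m t - X s)\<close> from below at \<open>c\<close> amounts to enlarging the drift at \<open>s\<close>, which turns the
  comparison of maxima into one of stop-loss transforms and hence of expectations of arbitrary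
  non-decreasing convex functions. Part (i) is the case \<open>s = 0\<close>, since the processes vanish there.
\<close>

section \<open>Uniqueness of joint laws\<close>

text \<open>The obstacle is degeneracy: all processes vanish almost surely at time \<open>0\<close>,
  and the definition speaks only of finite linear combinations. Multivariate densities are therefore
  avoided, and joint laws are handled through characteristic functions of linear combinations. This
  makes Cramer-Wold uniqueness the entry point; it is reduced to Levy's one-dimensional theorem by
  reweighting measures. Independence is realised on product spaces.

  Increment variances alone decide the comparison because the Hessian of log-sum-exp has vanishing
  row sums. With \<open>a = t powr (2 * H)\<close> and \<open>b = s powr (2 * H)\<close>, the
  increment variance of \<open>W\<close> is
  \<open>a powr K + b powr K - 2 * ((a + b) / 2) powr K\<close> plus
  \<open>2 powr (1 - K) * \<bar>s - t\<bar> powr (2 * H * K)\<close>. The first part is non-positive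
  by concavity, whence \<open>Y1\<close>. For \<open>Y2\<close> it must cancel at most half of the
  second part, and this is the delicate inequality.

  Existence of the expectations is assumed only for the suprema themselves. Every passage to the
  limit is thus dominated by a constant and by \<open>g\<close> of the supremum.\<close>

lemma distr_eq_if_char_eq:
  fixes X :: "'a \<Rightarrow> real" and Y :: "'b \<Rightarrow> real"
  assumes M: "finite_measure M" and N: "finite_measure N"
    and X[measurable]: "X \<in> borel_measurable M" and Y[measurable]: "Y \<in> borel_measurable N"
    and eq: "\<And>t. (CLINT x|M. iexp (t * X x)) = (CLINT y|N. iexp (t * Y y))"
  shows "distr M borel X = distr N borel Y"
proof -
  interpret M: finite_measure M by fact
  interpret N: finite_measure N by fact
  define c where "c = measure M (space M)"
  \<comment> \<open>At \<open>t = 0\<close> the hypothesis compares the total masses, so both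
    measures can be normalised by the same factor before Levy's theorem is applied. Masses other
    than 1 arise from the reweighted measures below.\<close>
  have cN: "c = measure N (space N)" using eq[of 0] by (simp add: c_def)
  show ?thesis
  proof (cases "c = 0")
    case True
    have "emeasure M (X -` A \<inter> space M) = 0" for A
      using emeasure_mono[of "X -` A \<inter> space M" "space M" M] True
      by (simp add: c_def M.emeasure_eq_measure measure_le_0_iff)
    moreover have "emeasure N (Y -` A \<inter> space N) = 0" for A
      using emeasure_mono[of "Y -` A \<inter> space N" "space N" N] True
      by (simp add: cN N.emeasure_eq_measure measure_le_0_iff)
    ultimately show ?thesis by (intro measure_eqI) (auto simp: emeasure_distr)
  next
    case False
    then have c: "c > 0" by (simp add: c_def zero_less_measure_iff)
    define M' where "M' = density M (\<lambda>_. ennreal (1 / c))"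
    define N' where "N' = density N (\<lambda>_. ennreal (1 / c))"
    have 1: "ennreal (1 / c) * ennreal c = 1"
      using c by (simp flip: ennreal_mult)
    interpret M': prob_space M'
      by standard (simp add: M'_def emeasure_density_const M.emeasure_eq_measure c_def[symmetric] 1)
    interpret N': prob_space N'
      by standard (simp add: N'_def emeasure_density_const N.emeasure_eq_measure cN[symmetric] 1)
    have [measurable]: "X \<in> borel_measurable M'" "Y \<in> borel_measurable N'"
      by (simp_all add: M'_def N'_def)
    have "char (distr M' borel X) = char (distr N' borel Y)"
      unfolding char_def
      by (rule ext, simp add: integral_distr, simp add: M'_def N'_def integral_density c less_imp_le
          integral_scaleR_right, insert eq, simp)
    then have "distr M' borel X = distr N' borel Y"
      by (intro Levy_uniqueness) auto
    then have *: "emeasure (distr M' borel X) A = emeasure (distr N' borel Y) A" for A by simp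
    have "emeasure M (X -` A \<inter> space M) = emeasure N (Y -` A \<inter> space N)" if [measurable]: "A \<in> sets borel" for A
    proof -
      have "ennreal (1 / c) * emeasure M (X -` A \<inter> space M) = ennreal (1 / c) * emeasure N (Y -` A \<inter> space N)"
        using *[of A] by (simp add: emeasure_distr M'_def N'_def emeasure_density_const)
      then show ?thesis using c
        by (simp add: M.emeasure_eq_measure N.emeasure_eq_measure flip: ennreal_mult)
    qed
    then show ?thesis by (intro measure_eqI) (auto simp: emeasure_distr)
  qed
qed

lemma integrable_if_norm_bounded:
  fixes f :: "'a \<Rightarrow> 'b::{banach, second_countable_topology}"
  assumes "finite_measure M" "f \<in> borel_measurable M" "\<And>x. norm (f x) \<le> C"
  shows "integrable M f"
  using assms by (intro finite_measure.integrable_const_bound[of _ _ C]) auto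

lemma integral_iexp_lincomb:
  assumes "finite_measure M" and [measurable]: "f \<in> borel_measurable M" "g \<in> borel_measurable M" "h \<in> borel_measurable M"
  shows "(CLINT x|M. iexp (f x) + (a * iexp (g x) + b * iexp (h x))) =
    (CLINT x|M. iexp (f x)) + (a * (CLINT x|M. iexp (g x)) + b * (CLINT x|M. iexp (h x)))"
proof -
  have [simp]: "integrable M (\<lambda>x. iexp (f x))" "integrable M (\<lambda>x. iexp (g x))" "integrable M (\<lambda>x. iexp (h x))"
    by (auto intro!: integrable_if_norm_bounded[OF assms(1), where C = 1])
  show ?thesis by simp
qed

lemma integral_of_real_plus_i:
  assumes "integrable M f" "integrable M g"
  shows "(CLINT x|M. complex_of_real (f x) + \<i> * complex_of_real (g x)) =
    complex_of_real (integral\<^sup>L M f) + \<i> * complex_of_real (integral\<^sup>L M g)"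
  using assms by (subst Bochner_Integration.integral_add) (auto intro: integrable_of_real)

text \<open>The induction generalises over the measures: the condition
  \<open>X j x \<in> A j\<close> is absorbed into the measure as a density, which leaves a cylinder
  over the smaller index set. The point to check is that the reweighted measures still give equal
  characteristic functions to combinations of the remaining coordinates. For this the roles are
  swapped: the trigonometric factor of the remaining coordinates becomes the weight, and
  one-dimensional uniqueness is applied to \<open>X j\<close>.\<close>

lemma emeasure_cylinder_eq_if_char_eq:
  fixes X :: "'i \<Rightarrow> 'a \<Rightarrow> real" and Y :: "'i \<Rightarrow> 'b \<Rightarrow> real"
  assumes "finite J" "finite_measure M" "finite_measure N"
    and "\<And>j. j \<in> J \<Longrightarrow> X j \<in> borel_measurable M" "\<And>j. j \<in> J \<Longrightarrow> Y j \<in> borel_measurable N"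
    and "\<And>b. (CLINT x|M. iexp (\<Sum>j\<in>J. b j * X j x)) = (CLINT y|N. iexp (\<Sum>j\<in>J. b j * Y j y))"
    and "\<And>j. j \<in> J \<Longrightarrow> A j \<in> sets borel"
  shows "emeasure M {x \<in> space M. \<forall>j\<in>J. X j x \<in> A j} = emeasure N {y \<in> space N. \<forall>j\<in>J. Y j y \<in> A j}"
  using assms
proof (induction J arbitrary: M N)
  case empty
  interpret M: finite_measure M by fact
  interpret N: finite_measure N by fact
  show ?case using empty.prems(5) by (simp add: M.emeasure_eq_measure N.emeasure_eq_measure)
next
  case (insert j J)
  interpret M: finite_measure M by fact
  interpret N: finite_measure N by fact
  have [measurable]: "X j \<in> borel_measurable M" "Y j \<in> borel_measurable N" "A j \<in> sets borel"
    "\<And>i. i \<in> J \<Longrightarrow> X i \<in> borel_measurable M" "\<And>i. i \<in> J \<Longrightarrow> Y i \<in> borel_measurable N"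
    using insert.prems by auto
  define M' where "M' = density M (\<lambda>x. ennreal (indicator (A j) (X j x)))"
  define N' where "N' = density N (\<lambda>x. ennreal (indicator (A j) (Y j x)))"
  have fin: "finite_measure M'" "finite_measure N'"
  proof -
    have "emeasure M' (space M') \<le> emeasure M (space M)"
      unfolding M'_def by (subst emeasure_density)
        (auto simp flip: nn_integral_indicator intro!: nn_integral_mono split: split_indicator)
    moreover have "emeasure N' (space N') \<le> emeasure N (space N)"
      unfolding N'_def by (subst emeasure_density)
        (auto simp flip: nn_integral_indicator intro!: nn_integral_mono split: split_indicator)
    ultimately show "finite_measure M'" "finite_measure N'"
      by (auto intro!: finite_measureI simp: M.emeasure_eq_measure N.emeasure_eq_measure top_unique)
  qed
  have char_eq: "(CLINT x|M'. iexp (\<Sum>i\<in>J. b i * X i x)) = (CLINT y|N'. iexp (\<Sum>i\<in>J. b i * Y i y))" for b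
  proof -
    define S where "S x = (\<Sum>i\<in>J. b i * X i x)" for x
    define R where "R x = (\<Sum>i\<in>J. b i * Y i x)" for x
    have [measurable]: "S \<in> borel_measurable M" "R \<in> borel_measurable N"
      unfolding S_def R_def by measurable
    have joint: "(CLINT x|M. iexp (t * X j x + r * S x)) = (CLINT y|N. iexp (t * Y j y + r * R y))" for t r
    proof -
      have "t * x + r * (\<Sum>i\<in>J. b i * f i) = (\<Sum>i\<in>insert j J. (if i = j then t else r * b i) * (if i = j then x else f i))"
        for x and f :: "'i \<Rightarrow> real"
        using insert.hyps by (auto simp: sum_distrib_left intro!: sum.cong)
      then have "t * X j x + r * S x = (\<Sum>i\<in>insert j J. (if i = j then t else r * b i) * X i x)"
        "t * Y j y + r * R y = (\<Sum>i\<in>insert j J. (if i = j then t else r * b i) * Y i y)" for x y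
        unfolding S_def R_def by (auto intro!: sum.cong)
      then show ?thesis using insert.prems(5) by simp
    qed
    \<comment> \<open>Under the weight \<open>1 + cos\<close> the exponential of the single
      coordinate is a combination of three joint exponentials, with coefficients \<open>0\<close>,
      \<open>1\<close> and \<open>-1\<close> at the remaining coordinates. They are spelled out so
      that each summand has the form treated in \<open>joint\<close>.\<close>
    have tw: "iexp (t * u) * complex_of_real (1 + cos (s + \<theta>)) =
      iexp (t * u + 0 * s) + (iexp \<theta> / 2 * iexp (t * u + 1 * s) + iexp (- \<theta>) / 2 * iexp (t * u + (-1) * s))" for t u s \<theta>
    proof -
      have "complex_of_real (cos (s + \<theta>)) = (iexp (s + \<theta>) + iexp (- (s + \<theta>))) / 2"
        by (simp add: cos_of_real[symmetric] cos_exp_eq algebra_simps)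
      moreover have "iexp \<theta> * iexp (t * u + 1 * s) = iexp (t * u) * iexp (s + \<theta>)"
        "iexp (- \<theta>) * iexp (t * u + (-1) * s) = iexp (t * u) * iexp (- (s + \<theta>))"
        unfolding exp_add[symmetric] by (simp_all add: algebra_simps)
      ultimately show ?thesis
        by (simp only: of_real_add of_real_1 distrib_left mult_1_right mult_zero_left add_0_right times_divide_eq_left times_divide_eq_right
            add_divide_distrib)
    qed
    \<comment> \<open>A complex exponential is no density, but \<open>1 + cos\<close> is
      non-negative. The phase \<open>\<theta>\<close> stays free because real and imaginary part are
      both recovered from it.\<close>
    have w: "(LINT x|M. indicator (A j) (X j x) * (1 + cos (S x + \<theta>))) =
        (LINT x|N. indicator (A j) (Y j x) * (1 + cos (R x + \<theta>)))" for \<theta>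
    proof -
      define M1 where "M1 = density M (\<lambda>x. ennreal (1 + cos (S x + \<theta>)))"
      define N1 where "N1 = density N (\<lambda>x. ennreal (1 + cos (R x + \<theta>)))"
      have nn: "0 \<le> 1 + cos r" "1 + cos r \<le> 2" "\<bar>1 + cos r\<bar> \<le> 2" for r :: real
        using cos_ge_minus_one[of r] cos_le_one[of r] by linarith+
      have iM: "integrable M (\<lambda>x. 1 + cos (S x + \<theta>))" and iN: "integrable N (\<lambda>x. 1 + cos (R x + \<theta>))"
        by (auto intro!: integrable_if_norm_bounded[where C = 2] M.finite_measure_axioms N.finite_measure_axioms simp: nn)
      have f1: "finite_measure M1" "finite_measure N1"
        unfolding M1_def N1_def using iM iN nn
        by (auto intro!: finite_measureI simp: emeasure_density nn_integral_eq_integral cong: nn_integral_cong)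
      have "(CLINT x|M1. iexp (t * X j x)) = (CLINT y|N1. iexp (t * Y j y))" for t
      proof -
        have "(CLINT x|M1. iexp (t * X j x)) = (CLINT x|M. iexp (t * X j x) * complex_of_real (1 + cos (S x + \<theta>)))"
          unfolding M1_def by (subst integral_density) (auto simp: nn scaleR_conv_of_real mult.commute)
        also have "\<dots> = (CLINT x|M. iexp (t * X j x + 0 * S x)) + (iexp \<theta> / 2 * (CLINT x|M. iexp (t * X j x + 1 * S x))
          + iexp (- \<theta>) / 2 * (CLINT x|M. iexp (t * X j x + (-1) * S x)))"
          unfolding tw by (rule integral_iexp_lincomb) (auto intro: M.finite_measure_axioms)
        also have "\<dots> = (CLINT x|N. iexp (t * Y j x + 0 * R x)) + (iexp \<theta> / 2 * (CLINT x|N. iexp (t * Y j x + 1 * R x))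
          + iexp (- \<theta>) / 2 * (CLINT x|N. iexp (t * Y j x + (-1) * R x)))"
          unfolding joint ..
        also have "\<dots> = (CLINT x|N. iexp (t * Y j x) * complex_of_real (1 + cos (R x + \<theta>)))"
          unfolding tw by (rule integral_iexp_lincomb[symmetric]) (auto intro: N.finite_measure_axioms)
        also have "\<dots> = (CLINT x|N1. iexp (t * Y j x))"
          unfolding N1_def by (subst integral_density) (auto simp: nn scaleR_conv_of_real mult.commute)
        finally show ?thesis .
      qed
      then have "distr M1 borel (X j) = distr N1 borel (Y j)"
        by (intro distr_eq_if_char_eq f1) (auto simp: M1_def N1_def)
      then have "(LINT x|distr M1 borel (X j). indicator (A j) x) = (LINT x|distr N1 borel (Y j). indicator (A j) x :: real)"
        by simp
      then have "(LINT x|M1. indicator (A j) (X j x)) = (LINT x|N1. indicator (A j) (Y j x) :: real)"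
        by (subst (asm) (1 2) integral_distr) (auto simp: M1_def N1_def)
      then show ?thesis
        unfolding M1_def N1_def
        by (subst (asm) (1 2) integral_density) (auto simp: nn mult.commute)
    qed
    have i: "integrable M (\<lambda>x. indicator (A j) (X j x) * cos (S x + \<theta>))"
      "integrable M (\<lambda>x. indicator (A j) (X j x) :: real)" for \<theta>
      by (auto intro!: integrable_if_norm_bounded[where C = 1] M.finite_measure_axioms split: split_indicator)
    have i': "integrable N (\<lambda>x. indicator (A j) (Y j x) * cos (R x + \<theta>))"
      "integrable N (\<lambda>x. indicator (A j) (Y j x) :: real)" for \<theta>
      by (auto intro!: integrable_if_norm_bounded[where C = 1] N.finite_measure_axioms split: split_indicator)
    have w': "(LINT x|M. indicator (A j) (X j x)) + (LINT x|M. indicator (A j) (X j x) * cos (S x + \<theta>)) =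
       (LINT x|N. indicator (A j) (Y j x)) + (LINT x|N. indicator (A j) (Y j x) * cos (R x + \<theta>))" for \<theta>
      using w[of \<theta>] i i' by (simp add: distrib_left)
    \<comment> \<open>Shifting the phase by \<open>pi\<close> changes the sign of the cosine, so
      subtracting the two identities removes the contribution of the constant
      \<open>1\<close>.\<close>
    have eq1: "(LINT x|M. indicator (A j) (X j x) * cos (S x + \<theta>)) = (LINT x|N. indicator (A j) (Y j x) * cos (R x + \<theta>))" for \<theta>
      using w'[of \<theta>] w'[of "\<theta> + pi"] by (simp flip: add.assoc)
    \<comment> \<open>The phases \<open>0\<close> and \<open>- (pi / 2)\<close> yield cosine and
      sine, hence real and imaginary part.\<close>
    have e: "indicator (A j) u *\<^sub>R iexp s = complex_of_real (indicator (A j) u * cos (s + 0))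
        + \<i> * complex_of_real (indicator (A j) u * cos (s + - (pi / 2)))" for u s
      by (simp add: cis_conv_exp[symmetric] complex_eq_iff cos_diff)
    have "(CLINT x|M'. iexp (S x)) = (CLINT x|M. indicator (A j) (X j x) *\<^sub>R iexp (S x))"
      unfolding M'_def by (subst integral_density) auto
    also have "\<dots> = complex_of_real (LINT x|M. indicator (A j) (X j x) * cos (S x + 0))
       + \<i> * complex_of_real (LINT x|M. indicator (A j) (X j x) * cos (S x + - (pi / 2)))"
      unfolding e
      by (rule integral_of_real_plus_i) (rule i)+
    also have "\<dots> = complex_of_real (LINT x|N. indicator (A j) (Y j x) * cos (R x + 0))
       + \<i> * complex_of_real (LINT x|N. indicator (A j) (Y j x) * cos (R x + - (pi / 2)))"
      unfolding eq1 ..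
    also have "\<dots> = (CLINT x|N. indicator (A j) (Y j x) *\<^sub>R iexp (R x))"
      unfolding e
      by (rule integral_of_real_plus_i[symmetric]) (rule i')+
    also have "\<dots> = (CLINT x|N'. iexp (R x))"
      unfolding N'_def by (subst integral_density) auto
    finally show ?thesis unfolding S_def R_def .
  qed
  have *: "emeasure M' {x \<in> space M'. \<forall>i\<in>J. X i x \<in> A i} = emeasure N' {y \<in> space N'. \<forall>i\<in>J. Y i y \<in> A i}"
    by (rule insert.IH) (use insert.prems fin char_eq in \<open>auto simp: M'_def N'_def\<close>)
  have [measurable]: "\<And>i. i \<in> J \<Longrightarrow> A i \<in> sets borel" using insert.prems by auto
  have "emeasure M {x \<in> space M. \<forall>i\<in>insert j J. X i x \<in> A i} = emeasure M' {x \<in> space M'. \<forall>i\<in>J. X i x \<in> A i}"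
    using insert.hyps unfolding M'_def
    by (subst emeasure_density)
       (auto simp flip: nn_integral_indicator intro!: nn_integral_cong simp: ennreal_indicator split: split_indicator)
  also note *
  also have "emeasure N' {x \<in> space N'. \<forall>i\<in>J. Y i x \<in> A i} = emeasure N {x \<in> space N. \<forall>i\<in>insert j J. Y i x \<in> A i}"
    using insert.hyps unfolding N'_def
    by (subst emeasure_density)
       (auto simp flip: nn_integral_indicator intro!: nn_integral_cong simp: ennreal_indicator split: split_indicator)
  finally show ?case .
qed

text \<open>The Cramer-Wold principle for families on two spaces: rectangles generate the product
  sigma-algebra and are stable under intersection, so agreement on cylinders suffices.\<close>

lemma distr_PiM_eq_if_char_eq:
  fixes X :: "'i \<Rightarrow> 'a \<Rightarrow> real" and Y :: "'i \<Rightarrow> 'b \<Rightarrow> real"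
  assumes J: "finite J" and M: "finite_measure M" and N: "finite_measure N"
    and X[measurable]: "\<And>j. j \<in> J \<Longrightarrow> X j \<in> borel_measurable M"
    and Y[measurable]: "\<And>j. j \<in> J \<Longrightarrow> Y j \<in> borel_measurable N"
    and eq: "\<And>b. (CLINT x|M. iexp (\<Sum>j\<in>J. b j * X j x)) = (CLINT y|N. iexp (\<Sum>j\<in>J. b j * Y j y))"
  shows "distr M (Pi\<^sub>M J (\<lambda>_. borel)) (\<lambda>x. \<lambda>j\<in>J. X j x) = distr N (Pi\<^sub>M J (\<lambda>_. borel)) (\<lambda>y. \<lambda>j\<in>J. Y j y)"
proof (rule measure_eqI_PiM_finite[OF J])
  fix A assume A: "\<And>i. i \<in> J \<Longrightarrow> A i \<in> sets (borel :: real measure)"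
  then have "emeasure (distr M (Pi\<^sub>M J (\<lambda>_. borel)) (\<lambda>x. \<lambda>j\<in>J. X j x)) (Pi\<^sub>E J A) = emeasure M {x \<in> space M. \<forall>j\<in>J. X j x \<in> A j}"
    using J by (subst emeasure_distr) (auto intro!: arg_cong2[where f = emeasure] sets_PiM_I_finite)
  also have "\<dots> = emeasure N {x \<in> space N. \<forall>j\<in>J. Y j x \<in> A j}"
    by (rule emeasure_cylinder_eq_if_char_eq) (use assms A in auto)
  also have "\<dots> = emeasure (distr N (Pi\<^sub>M J (\<lambda>_. borel)) (\<lambda>x. \<lambda>j\<in>J. Y j x)) (Pi\<^sub>E J A)"
    using J A by (subst emeasure_distr) (auto intro!: arg_cong2[where f = emeasure] sets_PiM_I_finite)
  finally show "emeasure (distr M (Pi\<^sub>M J (\<lambda>_. borel)) (\<lambda>x. \<lambda>j\<in>J. X j x)) (Pi\<^sub>E J A) = 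
    emeasure (distr N (Pi\<^sub>M J (\<lambda>_. borel)) (\<lambda>x. \<lambda>j\<in>J. Y j x)) (Pi\<^sub>E J A)" .
next
  interpret finite_measure M by fact
  show "range (\<lambda>_. space (Pi\<^sub>M J (\<lambda>_. borel :: real measure))) \<subseteq> prod_algebra J (\<lambda>_. borel)"
    using J by (auto simp: space_PiM intro!: prod_algebraI_finite)
  show "emeasure (distr M (Pi\<^sub>M J (\<lambda>_. borel)) (\<lambda>x. \<lambda>j\<in>J. X j x)) (space (Pi\<^sub>M J (\<lambda>_. borel :: real measure))) \<noteq> \<infinity>" for n :: nat
    by (subst emeasure_distr) (auto simp: emeasure_eq_measure)
qed auto

section \<open>Gaussian integration by parts\<close>

lemma integrable_mult_bounded:
  fixes f g :: "'a \<Rightarrow> real"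
  assumes f: "integrable M f" and [measurable]: "g \<in> borel_measurable M" and g: "\<And>x. \<bar>g x\<bar> \<le> C"
  shows "integrable M (\<lambda>x. f x * g x)"
proof (rule Bochner_Integration.integrable_bound[OF integrable_mult_right[of C M f]])
  have "0 \<le> C" using g[of undefined] by linarith
  then show "AE x in M. norm (f x * g x) \<le> norm (C * f x)"
    using g by (auto simp: abs_mult mult.commute[of C] intro!: AE_I2 mult_left_mono)
qed (use f in auto)

text \<open>The density \<open>n\<close> satisfies \<open>n' = - (x / \<sigma>\<^sup>2) * n\<close>,
  so the two integrands combine to the derivative of \<open>n * h\<close>. As \<open>h\<close> is
  bounded, \<open>n * h\<close> vanishes at both infinities and the derivative integrates to
  zero.\<close>

lemma normal_density_stein:
  fixes h h' :: "real \<Rightarrow> real"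
  assumes \<sigma>: "\<sigma> > 0"
    and deriv: "\<And>x. (h has_real_derivative h' x) (at x)"
    and cont: "\<And>x. isCont h' x"
    and bnd: "\<And>x. \<bar>h x\<bar> \<le> C" "\<And>x. \<bar>h' x\<bar> \<le> C"
  shows "(LINT x|lborel. normal_density 0 \<sigma> x * (x * h x)) = \<sigma>\<^sup>2 * (LINT x|lborel. normal_density 0 \<sigma> x * h' x)"
proof -
  define n where "n = normal_density 0 \<sigma>"
  have [measurable]: "h \<in> borel_measurable borel" "h' \<in> borel_measurable borel"
    using DERIV_isCont[OF deriv] cont by (auto intro!: borel_measurable_continuous_onI continuous_at_imp_continuous_on)
  have [measurable]: "n \<in> borel_measurable borel" by (simp add: n_def)
  have n': "(n has_real_derivative - (x / \<sigma>\<^sup>2) * n x) (at x)" for x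
    unfolding n_def normal_density_def using \<sigma>
    by (auto intro!: derivative_eq_intros simp: field_simps)
  have i1: "integrable lborel (\<lambda>x. n x * (x * h x))"
  proof -
    have "integrable lborel (\<lambda>x. n x * (x - 0) ^ 1)" unfolding n_def by (rule integrable_normal_moment[OF \<sigma>])
    then have "integrable lborel (\<lambda>x. n x * (x - 0) ^ 1 * h x)"
      by (rule integrable_mult_bounded) (use bnd in auto)
    then show ?thesis by (simp add: mult.assoc)
  qed
  have i2: "integrable lborel (\<lambda>x. n x * h' x)"
    by (rule integrable_mult_bounded) (use bnd \<sigma> in \<open>auto simp: n_def\<close>)
  define F where "F x = n x * h x" for x
  define F' where "F' x = n x * h' x - (1 / \<sigma>\<^sup>2) * (n x * (x * h x))" for x
  have dF: "(F has_real_derivative F' x) (at x)" for x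
    unfolding F_def F'_def by (auto intro!: derivative_eq_intros n' deriv simp: algebra_simps)
  have cF: "isCont F' x" for x
    unfolding F'_def using DERIV_isCont[OF n'] DERIV_isCont[OF deriv] cont by (intro continuous_intros) auto
  have iF: "integrable lborel F'"
    unfolding F'_def using i1 i2 by (intro Bochner_Integration.integrable_diff integrable_mult_right) auto
  have lim: "(F \<longlongrightarrow> 0) at_top" "(F \<longlongrightarrow> 0) at_bot"
  proof -
    have "(n \<longlongrightarrow> 0) at_top" "(n \<longlongrightarrow> 0) at_bot"
      unfolding n_def normal_density_def using \<sigma> by real_asymp+
    then show "(F \<longlongrightarrow> 0) at_top" "(F \<longlongrightarrow> 0) at_bot"
      unfolding F_def using bnd
      by (auto intro!: lim_null_mult_right_bounded[where B = C] always_eventually)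
  qed
  have "(LBINT x=-\<infinity>..\<infinity>. F' x) = 0 - 0"
    by (rule interval_integral_FTC_integrable[where F = F])
       (use dF cF iF lim in \<open>auto simp: ereal_tendsto_simps has_real_derivative_iff_has_vector_derivative set_integrable_def\<close>)
  then have "integral\<^sup>L lborel F' = 0"
    by (simp add: interval_lebesgue_integral_def set_lebesgue_integral_def)
  moreover have "integral\<^sup>L lborel F' = (LINT x|lborel. n x * h' x) - (1 / \<sigma>\<^sup>2) * (LINT x|lborel. n x * (x * h x))"
    unfolding F'_def using i1 i2 by (simp add: integral_mult_right_zero[symmetric] del: integral_mult_right_zero integral_divide_zero)
  ultimately show ?thesis using \<sigma> by (simp add: n_def field_simps)
qed

lemma (in prob_space) normal_distributed_char:
  assumes X: "distributed M lborel X (normal_density 0 \<sigma>)" and \<sigma>: "\<sigma> > 0"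
  shows "(CLINT x|M. iexp (t * X x)) = complex_of_real (exp (- (\<sigma>\<^sup>2 * t\<^sup>2) / 2))"
proof -
  have Z: "distributed M lborel (\<lambda>x. (X x - 0) / \<sigma>) std_normal_density"
    using normal_standard_normal_convert[OF \<sigma>] X by blast
  have m[measurable]: "X \<in> borel_measurable M" using distributed_measurable[OF X] by simp
  have "complex_of_real (exp (- (\<sigma>\<^sup>2 * t\<^sup>2) / 2)) = char std_normal_distribution (\<sigma> * t)"
    by (simp add: char_std_normal_distribution power_mult_distrib)
  also have "\<dots> = (CLINT x|M. iexp (\<sigma> * t * ((X x - 0) / \<sigma>)))"
    unfolding char_def distributed_distr_eq_density[OF Z, symmetric] by (subst integral_distr) auto
  also have "\<dots> = (CLINT x|M. iexp (t * X x))" using \<sigma> by simp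
  finally show ?thesis ..
qed

text \<open>Leads from characteristic functions back to a density, which Stein's identity on the
  line requires. The comparison partner is the identity map on the normal law itself.\<close>

lemma (in prob_space) distributed_normal_if_char:
  assumes [measurable]: "X \<in> borel_measurable M" and v: "v > 0"
    and char: "\<And>t. (CLINT x|M. iexp (t * X x)) = complex_of_real (exp (- (v * t\<^sup>2) / 2))"
  shows "distributed M lborel X (normal_density 0 (sqrt v))"
proof -
  define D where "D = density lborel (normal_density 0 (sqrt v))"
  interpret D: prob_space D unfolding D_def using v by (intro prob_space_normal_density) simp
  have "distributed D lborel (\<lambda>x. x) (normal_density 0 (sqrt v))"
    unfolding distributed_def D_def by (auto intro: measure_eqI simp: emeasure_distr)
  then have charD: "(CLINT x|D. iexp (t * x)) = complex_of_real (exp (- (v * t\<^sup>2) / 2))" for t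
    using D.normal_distributed_char[of "\<lambda>x. x" "sqrt v" t] v by simp
  have "distr M borel X = distr D borel (\<lambda>x. x)"
    by (rule distr_eq_if_char_eq[OF finite_measure_axioms D.finite_measure_axioms])
       (simp_all only: charD char, simp_all add: D_def)
  then have "distr M borel X = D"
    by (simp add: D_def distr_id2)
  then have "distr M lborel X = D"
    by (metis distr_cong sets_lborel)
  then show ?thesis unfolding distributed_def D_def by auto
qed

lemma (in prob_space) gaussian_stein:
  assumes [measurable]: "U \<in> borel_measurable M" and v: "v > 0"
    and char: "\<And>t. (CLINT x|M. iexp (t * U x)) = complex_of_real (exp (- (v * t\<^sup>2) / 2))"
    and deriv: "\<And>x. (h has_real_derivative h' x) (at x)"
    and cont: "\<And>x. isCont h' x"
    and bnd: "\<And>x. \<bar>h x\<bar> \<le> C" "\<And>x. \<bar>h' x\<bar> \<le> C"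
  shows "expectation (\<lambda>x. U x * h (U x)) = v * expectation (\<lambda>x. h' (U x))"
proof -
  have [measurable]: "h \<in> borel_measurable borel" "h' \<in> borel_measurable borel"
    using DERIV_isCont[OF deriv] cont by (auto intro!: borel_measurable_continuous_onI continuous_at_imp_continuous_on)
  have D: "distributed M lborel U (normal_density 0 (sqrt v))"
    by (rule distributed_normal_if_char) (use v char in auto)
  have "expectation (\<lambda>x. U x * h (U x)) = (LINT x|lborel. normal_density 0 (sqrt v) x * (x * h x))"
    by (rule distributed_integral[OF D, symmetric]) auto
  also have "\<dots> = v * (LINT x|lborel. normal_density 0 (sqrt v) x * h' x)"
    using normal_density_stein[of "sqrt v" h h' C] v deriv cont bnd by simp
  also have "(LINT x|lborel. normal_density 0 (sqrt v) x * h' x) = expectation (\<lambda>x. h' (U x))"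
    by (rule distributed_integral[OF D]) auto
  finally show ?thesis .
qed

text \<open>The vector \<open>V j - (c j / v) U\<close> is uncorrelated with \<open>U\<close>, hence independent of it: its joint
  law with \<open>U\<close> is that of the pair taken on two copies of the space. Stein's identity in the first
  copy then gives the claim.\<close>

lemma (in prob_space) gaussian_integration_by_parts:
  fixes U :: "'a \<Rightarrow> real" and V :: "'i \<Rightarrow> 'a \<Rightarrow> real" and f :: "('i \<Rightarrow> real) \<Rightarrow> real"
  assumes J: "finite J" and U[measurable]: "U \<in> borel_measurable M" and iU: "integrable M U"
    and V[measurable]: "\<And>j. j \<in> J \<Longrightarrow> V j \<in> borel_measurable M" and v: "v > 0"
    and char: "\<And>s b. (CLINT x|M. iexp (s * U x + (\<Sum>j\<in>J. b j * V j x))) =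
      complex_of_real (exp (- (v * s\<^sup>2 / 2) - s * (\<Sum>j\<in>J. b j * c j))) * (CLINT x|M. iexp (\<Sum>j\<in>J. b j * V j x))"
    and f[measurable]: "f \<in> borel_measurable (Pi\<^sub>M J (\<lambda>_. borel))"
    and D[measurable]: "\<And>j. j \<in> J \<Longrightarrow> D j \<in> borel_measurable (Pi\<^sub>M J (\<lambda>_. borel))"
    and restr: "\<And>x. f (restrict x J) = f x" "\<And>j x. j \<in> J \<Longrightarrow> D j (restrict x J) = D j x"
    and bnd: "\<And>x. \<bar>f x\<bar> \<le> C" "\<And>j x. j \<in> J \<Longrightarrow> \<bar>D j x\<bar> \<le> C"
    and deriv: "\<And>a r u. ((\<lambda>u. f (\<lambda>j. a j * u + r j)) has_real_derivative
        (\<Sum>j\<in>J. a j * D j (\<lambda>j. a j * u + r j))) (at u)"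
    and cont: "\<And>a r u j. j \<in> J \<Longrightarrow> isCont (\<lambda>u. D j (\<lambda>j. a j * u + r j)) u"
  shows "expectation (\<lambda>x. U x * f (\<lambda>j. V j x)) = (\<Sum>j\<in>J. c j * expectation (\<lambda>x. D j (\<lambda>j. V j x)))"
proof -
  interpret P: pair_prob_space M M ..
  \<comment> \<open>In the hypothesis \<open>char\<close>, \<open>v\<close> plays the role of the
    variance of \<open>U\<close> and \<open>c j\<close> that of the covariance of \<open>U\<close>
    and \<open>V j\<close>. Hence \<open>a j\<close> is the regression coefficient and
    \<open>R j\<close> the residual.\<close>
  define a where "a j = c j / v" for j
  define R where "R j x = V j x - a j * U x" for j x
  have R[measurable]: "\<And>j. j \<in> J \<Longrightarrow> R j \<in> borel_measurable M" unfolding R_def by measurable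
  have charR: "(CLINT x|M. iexp (s * U x + (\<Sum>j\<in>J. b j * R j x))) =
      complex_of_real (exp (- (v * s\<^sup>2) / 2)) * (CLINT x|M. iexp (\<Sum>j\<in>J. b j * R j x))" for s b
  proof -
    define k where "k = (\<Sum>j\<in>J. b j * a j)"
    have k: "(\<Sum>j\<in>J. b j * c j) = v * k"
      using v by (simp add: k_def a_def sum_distrib_left)
    have R': "s * U x + (\<Sum>j\<in>J. b j * R j x) = (s - k) * U x + (\<Sum>j\<in>J. b j * V j x)" for x s
      by (simp add: R_def k_def algebra_simps sum_subtractf sum_distrib_left sum_distrib_right)
    have A: "(CLINT x|M. iexp (s * U x + (\<Sum>j\<in>J. b j * R j x))) =
      complex_of_real (exp (- (v * (s - k)\<^sup>2 / 2) - (s - k) * (v * k))) * (CLINT x|M. iexp (\<Sum>j\<in>J. b j * V j x))" for s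
      unfolding R' char k ..
    \<comment> \<open>The terms linear in \<open>s\<close> cancel, which expresses that
      \<open>U\<close> and the residuals are uncorrelated. What remains besides the Gaussian factor
      is the value at \<open>s = 0\<close>.\<close>
    have "- (v * (s - k)\<^sup>2 / 2) - (s - k) * (v * k) = - (v * s\<^sup>2) / 2 + (- (v * (0 - k)\<^sup>2 / 2) - (0 - k) * (v * k))"
      by (simp add: power2_eq_square algebra_simps add_divide_distrib diff_divide_distrib)
    then have "complex_of_real (exp (- (v * (s - k)\<^sup>2 / 2) - (s - k) * (v * k))) =
        complex_of_real (exp (- (v * s\<^sup>2) / 2)) * complex_of_real (exp (- (v * (0 - k)\<^sup>2 / 2) - (0 - k) * (v * k)))"
      by (simp only: exp_add of_real_mult)
    then have "(CLINT x|M. iexp (s * U x + (\<Sum>j\<in>J. b j * R j x))) =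
      complex_of_real (exp (- (v * s\<^sup>2) / 2)) * (CLINT x|M. iexp (0 * U x + (\<Sum>j\<in>J. b j * R j x)))"
      unfolding A by (simp only: mult.assoc)
    then show ?thesis by (simp only: mult_zero_left add_0)
  qed
  have charU: "(CLINT x|M. iexp (t * U x)) = complex_of_real (exp (- (v * t\<^sup>2) / 2))" for t
    using charR[of t "\<lambda>_. 0"] by (simp add: prob_space)
  \<comment> \<open>The index \<open>None\<close> carries \<open>U\<close> and \<open>Some j\<close>
    the residual \<open>R j\<close>. The family \<open>X\<close> lives on one copy of the space,
    while \<open>X'\<close> reads \<open>U\<close> from the first and the residuals from the second
    factor of the product.\<close>
  define K where "K = insert None (Some ` J)"
  define X where "X k x = (case k of None \<Rightarrow> U x | Some j \<Rightarrow> R j x)" for k x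
  define X' where "X' k z = (case k of None \<Rightarrow> U (fst z) | Some j \<Rightarrow> R j (snd z))" for k z
  have K: "finite K" using J by (simp add: K_def)
  have [measurable]: "\<And>k. k \<in> K \<Longrightarrow> X k \<in> borel_measurable M" "\<And>k. k \<in> K \<Longrightarrow> X' k \<in> borel_measurable (M \<Otimes>\<^sub>M M)"
    unfolding X_def X'_def K_def by auto
  have sumK: "(\<Sum>k\<in>K. b k * F k) = b None * F None + (\<Sum>j\<in>J. b (Some j) * F (Some j))" for b F :: "'i option \<Rightarrow> real"
    unfolding K_def using J by (subst sum.insert) (auto simp: sum.reindex)
  have law: "distr M (Pi\<^sub>M K (\<lambda>_. borel)) (\<lambda>x. \<lambda>k\<in>K. X k x) = distr (M \<Otimes>\<^sub>M M) (Pi\<^sub>M K (\<lambda>_. borel)) (\<lambda>z. \<lambda>k\<in>K. X' k z)"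
  proof (rule distr_PiM_eq_if_char_eq[OF K])
    fix b :: "'i option \<Rightarrow> real"
    have "(CLINT z|M \<Otimes>\<^sub>M M. iexp (\<Sum>k\<in>K. b k * X' k z)) =
        (CLINT z|M \<Otimes>\<^sub>M M. (\<lambda>(x, y). iexp (b None * U x) * iexp (\<Sum>j\<in>J. b (Some j) * R j y)) z)"
      unfolding sumK by (auto simp: X'_def distrib_left exp_add intro!: Bochner_Integration.integral_cong)
    also have "\<dots> = (CLINT x|M. CLINT y|M. iexp (b None * U x) * iexp (\<Sum>j\<in>J. b (Some j) * R j y))"
      by (subst P.integral_fst'[symmetric])
         (auto intro!: integrable_if_norm_bounded[where C = 1] P.finite_measure_axioms simp: norm_mult)
    also have "\<dots> = (CLINT x|M. iexp (\<Sum>k\<in>K. b k * X k x))"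
      by (simp only: sumK integral_mult_right_zero integral_mult_left_zero charU X_def option.case charR)
    finally show "(CLINT x|M. iexp (\<Sum>k\<in>K. b k * X k x)) = (CLINT z|M \<Otimes>\<^sub>M M. iexp (\<Sum>k\<in>K. b k * X' k z))" ..
  qed (auto intro: finite_measure_axioms P.finite_measure_axioms)
  have transfer: "expectation (\<lambda>x. h (\<lambda>k\<in>K. X k x)) = (LINT z|(M \<Otimes>\<^sub>M M). h (\<lambda>k\<in>K. X' k z))"
    if [measurable]: "h \<in> borel_measurable (Pi\<^sub>M K (\<lambda>_. borel))" for h :: "('i option \<Rightarrow> real) \<Rightarrow> real"
    using arg_cong[OF law, of "\<lambda>m. integral\<^sup>L m h"] by (simp add: integral_distr)
  have [measurable]: "(\<lambda>x. x None) \<in> borel_measurable (Pi\<^sub>M K (\<lambda>_. borel))"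
    "\<And>j. j \<in> J \<Longrightarrow> (\<lambda>x. x (Some j)) \<in> borel_measurable (Pi\<^sub>M K (\<lambda>_. borel))"
    by (auto intro!: measurable_component_singleton simp: K_def)
  \<comment> \<open>Recovers \<open>V\<close> from \<open>U\<close> and the residuals. The result is
    extensional on \<open>J\<close>, and \<open>restr\<close> lets \<open>f\<close> and
    \<open>D j\<close> ignore this.\<close>
  define g where "g x = (\<lambda>j\<in>J. a j * x None + x (Some j))" for x :: "'i option \<Rightarrow> real"
  have [measurable]: "g \<in> Pi\<^sub>M K (\<lambda>_. borel) \<rightarrow>\<^sub>M Pi\<^sub>M J (\<lambda>_. borel)"
    unfolding g_def by measurable
  have gX: "f (g (\<lambda>k\<in>K. X k x)) = f (\<lambda>j. V j x)" "j \<in> J \<Longrightarrow> D j (g (\<lambda>k\<in>K. X k x)) = D j (\<lambda>j. V j x)" for x j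
  proof -
    have "g (\<lambda>k\<in>K. X k x) = restrict (\<lambda>j. V j x) J"
      by (auto simp: g_def K_def X_def R_def restrict_def)
    then show "f (g (\<lambda>k\<in>K. X k x)) = f (\<lambda>j. V j x)" "j \<in> J \<Longrightarrow> D j (g (\<lambda>k\<in>K. X k x)) = D j (\<lambda>j. V j x)"
      by (auto simp: restr)
  qed
  have gX': "f (g (\<lambda>k\<in>K. X' k (x, y))) = f (\<lambda>j. a j * U x + R j y)"
    "j \<in> J \<Longrightarrow> D j (g (\<lambda>k\<in>K. X' k (x, y))) = D j (\<lambda>j. a j * U x + R j y)" for x y j
  proof -
    have "g (\<lambda>k\<in>K. X' k (x, y)) = restrict (\<lambda>j. a j * U x + R j y) J"
      by (auto simp: g_def K_def X'_def restrict_def)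
    then show "f (g (\<lambda>k\<in>K. X' k (x, y))) = f (\<lambda>j. a j * U x + R j y)"
      "j \<in> J \<Longrightarrow> D j (g (\<lambda>k\<in>K. X' k (x, y))) = D j (\<lambda>j. a j * U x + R j y)"
      by (auto simp: restr)
  qed
  have N: "None \<in> K" by (simp add: K_def)
  have iD: "integrable M (\<lambda>x. D j (\<lambda>i. V i x))" if "j \<in> J" for j
    using bnd(2) that measurable_compose[OF measurable_compose[of "\<lambda>x. \<lambda>k\<in>K. X k x" M _ g] D[OF that]]
    by (intro integrable_if_norm_bounded[where C = C] finite_measure_axioms) (auto simp: gX)
  \<comment> \<open>For a frozen point \<open>y\<close> of the second copy the argument of
    \<open>f\<close> is affine in \<open>U\<close> alone, so the one-dimensional identity applies;
    the factor \<open>v\<close> turns \<open>a j\<close> back into \<open>c j\<close>.\<close>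
  have stein: "expectation (\<lambda>x. U x * f (\<lambda>j. a j * U x + R j y)) =
      expectation (\<lambda>x. \<Sum>j\<in>J. c j * D j (\<lambda>j. a j * U x + R j y))" for y
  proof -
    have "expectation (\<lambda>x. U x * f (\<lambda>j. a j * U x + R j y)) =
        v * expectation (\<lambda>x. \<Sum>j\<in>J. a j * D j (\<lambda>j. a j * U x + R j y))"
    proof (rule gaussian_stein[OF U v charU])
      show "isCont (\<lambda>u. \<Sum>j\<in>J. a j * D j (\<lambda>j. a j * u + R j y)) x" for x
        using cont by (intro continuous_intros) auto
      show "\<bar>f (\<lambda>j. a j * x + R j y)\<bar> \<le> C + (\<Sum>j\<in>J. \<bar>a j\<bar> * C)" for x
      proof -
        have "0 \<le> C" using bnd(1)[of undefined] by linarith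
        then show ?thesis using bnd(1) by (intro add_increasing2 sum_nonneg) auto
      qed
      show "\<bar>\<Sum>j\<in>J. a j * D j (\<lambda>j. a j * x + R j y)\<bar> \<le> C + (\<Sum>j\<in>J. \<bar>a j\<bar> * C)" for x
      proof -
        have "0 \<le> C" using bnd(1)[of undefined] by linarith
        then show ?thesis using bnd(2)
          by (intro add_increasing order.trans[OF sum_abs] sum_mono) (auto simp: abs_mult intro!: mult_left_mono)
      qed
    qed (rule deriv)
    also have "\<dots> = expectation (\<lambda>x. v * (\<Sum>j\<in>J. a j * D j (\<lambda>j. a j * U x + R j y)))" by simp
    also have "\<dots> = expectation (\<lambda>x. \<Sum>j\<in>J. c j * D j (\<lambda>j. a j * U x + R j y))"
      using v by (simp add: sum_distrib_left a_def)
    finally show ?thesis .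
  qed
  have mX'[measurable]: "(\<lambda>z. f (\<lambda>j. a j * U (fst z) + R j (snd z))) \<in> borel_measurable (M \<Otimes>\<^sub>M M)"
    "\<And>j. j \<in> J \<Longrightarrow> (\<lambda>z. D j (\<lambda>j. a j * U (fst z) + R j (snd z))) \<in> borel_measurable (M \<Otimes>\<^sub>M M)"
  proof -
    have [measurable]: "(\<lambda>z. \<lambda>k\<in>K. X' k z) \<in> M \<Otimes>\<^sub>M M \<rightarrow>\<^sub>M Pi\<^sub>M K (\<lambda>_. borel)" by measurable
    have "(\<lambda>z. f (g (\<lambda>k\<in>K. X' k z))) \<in> borel_measurable (M \<Otimes>\<^sub>M M)" by measurable
    then show "(\<lambda>z. f (\<lambda>j. a j * U (fst z) + R j (snd z))) \<in> borel_measurable (M \<Otimes>\<^sub>M M)"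
      by (simp add: gX'(1)[of "fst z" "snd z" for z, simplified prod.collapse])
    fix j assume j[measurable]: "j \<in> J"
    have "(\<lambda>z. D j (g (\<lambda>k\<in>K. X' k z))) \<in> borel_measurable (M \<Otimes>\<^sub>M M)" by measurable
    then show "(\<lambda>z. D j (\<lambda>j. a j * U (fst z) + R j (snd z))) \<in> borel_measurable (M \<Otimes>\<^sub>M M)"
      using j by (simp add: gX'(2)[of j "fst z" "snd z" for z, simplified prod.collapse])
  qed
  have "expectation (\<lambda>x. U x * f (\<lambda>j. V j x)) = expectation (\<lambda>x. (\<lambda>y. y None * f (g y)) (\<lambda>k\<in>K. X k x))"
    using N by (simp add: gX) (simp add: X_def)
  also have "\<dots> = (LINT z|(M \<Otimes>\<^sub>M M). (\<lambda>y. y None * f (g y)) (\<lambda>k\<in>K. X' k z))"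
    by (rule transfer) measurable
  also have "\<dots> = (LINT z|(M \<Otimes>\<^sub>M M). (\<lambda>(x, y). U x * f (\<lambda>j. a j * U x + R j y)) z)"
    using N by (intro Bochner_Integration.integral_cong) (auto simp: gX', auto simp: X'_def)
  also have "\<dots> = (LINT y|M. LINT x|M. U x * f (\<lambda>j. a j * U x + R j y))"
  proof (subst P.integral_snd)
    have "integrable (distr (M \<Otimes>\<^sub>M M) M fst) U" using iU by (simp add: distr_pair_fst)
    then have "integrable (M \<Otimes>\<^sub>M M) (\<lambda>z. U (fst z))" by (subst (asm) integrable_distr_eq) auto
    then have "integrable (M \<Otimes>\<^sub>M M) (\<lambda>z. U (fst z) * f (\<lambda>j. a j * U (fst z) + R j (snd z)))"
      by (rule integrable_mult_bounded) (use bnd in auto)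
    then show "integrable (M \<Otimes>\<^sub>M M) (\<lambda>(x, y). U x * f (\<lambda>j. a j * U x + R j y))"
      by (simp add: split_beta')
  qed simp
  also have "\<dots> = (LINT y|M. LINT x|M. (\<Sum>j\<in>J. c j * D j (\<lambda>j. a j * U x + R j y)))"
    unfolding stein ..
  also have "\<dots> = (LINT z|(M \<Otimes>\<^sub>M M). (\<lambda>(x, y). \<Sum>j\<in>J. c j * D j (\<lambda>j. a j * U x + R j y)) z)"
  proof (subst P.integral_snd)
    show "integrable (M \<Otimes>\<^sub>M M) (\<lambda>(x, y). \<Sum>j\<in>J. c j * D j (\<lambda>j. a j * U x + R j y))"
      unfolding split_beta' using bnd(2)
      by (intro Bochner_Integration.integrable_sum integrable_mult_right
          integrable_if_norm_bounded[where C = C] P.finite_measure_axioms) auto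
  qed simp
  also have "\<dots> = (LINT z|(M \<Otimes>\<^sub>M M). (\<lambda>y. \<Sum>j\<in>J. c j * D j (g y)) (\<lambda>k\<in>K. X' k z))"
    by (intro Bochner_Integration.integral_cong) (auto simp: gX')
  also have "\<dots> = expectation (\<lambda>x. (\<lambda>y. \<Sum>j\<in>J. c j * D j (g y)) (\<lambda>k\<in>K. X k x))"
    by (rule transfer[symmetric]) measurable
  also have "\<dots> = (\<Sum>j\<in>J. c j * expectation (\<lambda>x. D j (\<lambda>j. V j x)))"
    using iD by (simp add: gX)
  finally show ?thesis .
qed

section \<open>Smooth maximum\<close>

lemma distr_pair_snd:
  assumes "prob_space M" "prob_space N"
  shows "distr (M \<Otimes>\<^sub>M N) N snd = N"
proof (rule measure_eqI)
  interpret M: prob_space M by fact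
  interpret N: prob_space N by fact
  fix A assume "A \<in> sets (distr (M \<Otimes>\<^sub>M N) N snd)"
  then have A: "A \<in> sets N" by simp
  then have "snd -` A \<inter> space (M \<Otimes>\<^sub>M N) = space M \<times> A"
    by (auto simp: space_pair_measure dest: sets.sets_into_space)
  then show "emeasure (distr (M \<Otimes>\<^sub>M N) N snd) A = emeasure N A"
    using A by (simp add: emeasure_distr N.emeasure_pair_measure_Times M.emeasure_space_1)
qed simp

lemma integrable_square_mult:
  fixes f g :: "'a \<Rightarrow> real"
  assumes [measurable]: "f \<in> borel_measurable M" "g \<in> borel_measurable M"
    and "integrable M (\<lambda>x. (f x)\<^sup>2)" "integrable M (\<lambda>x. (g x)\<^sup>2)"
  shows "integrable M (\<lambda>x. f x * g x)"
proof (rule Bochner_Integration.integrable_bound[OF Bochner_Integration.integrable_add[OF assms(3,4)]])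
  have "\<bar>f x * g x\<bar> \<le> (f x)\<^sup>2 + (g x)\<^sup>2" for x
    using sum_squares_bound[of "f x" "g x"] sum_squares_bound[of "f x" "- g x"] 
      zero_le_power2[of "f x"] zero_le_power2[of "g x"] by (simp add: abs_le_iff)
  then show "AE x in M. norm (f x * g x) \<le> norm ((f x)\<^sup>2 + (g x)\<^sup>2)" by simp
qed auto

text \<open>The mean value inequality bounds all difference quotients by \<open>w\<close>, so
  dominated convergence applies along every sequence of increments tending to zero.\<close>

lemma has_derivative_expectation:
  fixes f f' :: "real \<Rightarrow> 'a \<Rightarrow> real"
  assumes f: "\<And>t. integrable M (f t)" and f'[measurable]: "\<And>t. f' t \<in> borel_measurable M"
    and deriv: "\<And>t x. ((\<lambda>t. f t x) has_real_derivative f' t x) (at t)"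
    and bnd: "\<And>t x. \<bar>f' t x\<bar> \<le> w x" and w: "integrable M w"
  shows "((\<lambda>t. LINT x|M. f t x) has_real_derivative (LINT x|M. f' t x)) (at t)"
  unfolding DERIV_def tendsto_at_iff_sequentially comp_def
proof (intro allI impI)
  fix h :: "nat \<Rightarrow> real" assume h: "\<forall>i. h i \<in> UNIV - {0}" "h \<longlonglongrightarrow> 0"
  have [measurable]: "\<And>t. f t \<in> borel_measurable M" using f by auto
  have "(\<lambda>i. LINT x|M. (f (t + h i) x - f t x) / h i) \<longlonglongrightarrow> (LINT x|M. f' t x)"
  proof (rule integral_dominated_convergence[OF _ _ w])
    have "(\<lambda>i. (f (t + h i) x - f t x) / h i) \<longlonglongrightarrow> f' t x" for x
      using deriv[where x = x and t = t] h unfolding DERIV_def tendsto_at_iff_sequentially comp_def by blast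
    then show "AE x in M. (\<lambda>i. (f (t + h i) x - f t x) / h i) \<longlonglongrightarrow> f' t x" by simp
    have "\<bar>f (t + h i) x - f t x\<bar> \<le> w x * \<bar>h i\<bar>" for i x
      using field_differentiable_bound[of UNIV "\<lambda>t. f t x" "\<lambda>t. f' t x" "w x" "t + h i" t] deriv bnd
      by auto
    then show "AE x in M. norm ((f (t + h i) x - f t x) / h i) \<le> w x" for i
      using h(1) by (auto simp: divide_simps)
  qed auto
  moreover have "(LINT x|M. (f (t + h i) x - f t x) / h i) = ((LINT x|M. f (t + h i) x) - (LINT x|M. f t x)) / h i" for i
    using f by simp
  ultimately show "(\<lambda>i. ((LINT x|M. f (t + h i) x) - (LINT x|M. f t x)) / h i) \<longlonglongrightarrow> (LINT x|M. f' t x)"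
    by (simp only:)
qed

text \<open>The Gibbs weights at inverse temperature \<open>\<beta>\<close>; they are the partial
  derivatives of \<open>log_sum_exp\<close>.\<close>

definition softmax :: "'i set \<Rightarrow> ('i \<Rightarrow> real) \<Rightarrow> real \<Rightarrow> 'i \<Rightarrow> ('i \<Rightarrow> real) \<Rightarrow> real" where
  "softmax J m \<beta> i x = exp (\<beta> * (x i + m i)) / (\<Sum>k\<in>J. exp (\<beta> * (x k + m k)))"

definition log_sum_exp :: "'i set \<Rightarrow> ('i \<Rightarrow> real) \<Rightarrow> real \<Rightarrow> ('i \<Rightarrow> real) \<Rightarrow> real" where
  "log_sum_exp J m \<beta> x = ln (\<Sum>k\<in>J. exp (\<beta> * (x k + m k))) / \<beta>"

context
  fixes J :: "'i set" and m :: "'i \<Rightarrow> real" and \<beta> :: real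
  assumes J: "finite J" "J \<noteq> {}" and \<beta>: "\<beta> > 0"
begin

lemma sum_exp_pos: "0 < (\<Sum>k\<in>J. exp (\<beta> * (x k + m k)))"
  using J by (intro sum_pos) auto

lemma softmax_nonneg: "0 \<le> softmax J m \<beta> i x"
  using sum_exp_pos[of x] by (simp add: softmax_def less_imp_le)

lemma sum_softmax: "(\<Sum>i\<in>J. softmax J m \<beta> i x) = 1"
  using sum_exp_pos[of x] by (simp add: softmax_def flip: sum_divide_distrib)

lemma softmax_le_1: "i \<in> J \<Longrightarrow> softmax J m \<beta> i x \<le> 1"
  using member_le_sum[of i J "\<lambda>i. softmax J m \<beta> i x"] J softmax_nonneg by (simp add: sum_softmax)

text \<open>The bracket is the Hessian of \<open>log_sum_exp\<close>: \<open>\<beta>\<close> times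
  the covariance matrix of the indicators of a random index drawn with the Gibbs weights. The chain
  rule is stated along a curve \<open>x\<close>, which serves the affine lines needed for
  integration by parts.\<close>

lemma softmax_has_derivative:
  assumes "\<And>k. k \<in> J \<Longrightarrow> ((\<lambda>u. x u k) has_real_derivative x' k) (at u)" "i \<in> J"
  shows "((\<lambda>u. softmax J m \<beta> i (x u)) has_real_derivative
    (\<Sum>j\<in>J. x' j * (\<beta> * (softmax J m \<beta> i (x u) * of_bool (i = j) - softmax J m \<beta> i (x u) * softmax J m \<beta> j (x u))))) (at u)"
proof -
  define S where "S = (\<Sum>k\<in>J. exp (\<beta> * (x u k + m k)))"
  define S' where "S' = (\<Sum>k\<in>J. exp (\<beta> * (x u k + m k)) * (\<beta> * x' k))"
  have S: "S > 0" unfolding S_def by (rule sum_exp_pos)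
  have "((\<lambda>u. \<Sum>k\<in>J. exp (\<beta> * (x u k + m k))) has_real_derivative S') (at u)"
    unfolding S'_def using assms by (auto intro!: derivative_eq_intros simp: mult_ac)
  moreover have "((\<lambda>u. exp (\<beta> * (x u i + m i))) has_real_derivative exp (\<beta> * (x u i + m i)) * (\<beta> * x' i)) (at u)"
    using assms by (auto intro!: derivative_eq_intros simp: mult_ac)
  ultimately have "((\<lambda>u. softmax J m \<beta> i (x u)) has_real_derivative
      (exp (\<beta> * (x u i + m i)) * (\<beta> * x' i) * S - exp (\<beta> * (x u i + m i)) * S') / (S * S)) (at u)"
    unfolding softmax_def using S by (auto intro!: DERIV_divide simp: S_def)
  moreover have "(exp (\<beta> * (x u i + m i)) * (\<beta> * x' i) * S - exp (\<beta> * (x u i + m i)) * S') / (S * S) =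
      softmax J m \<beta> i (x u) * (\<beta> * x' i) - softmax J m \<beta> i (x u) * (S' / S)"
    using S by (simp add: softmax_def S_def[symmetric] diff_divide_distrib)
  moreover have "S' / S = (\<Sum>j\<in>J. softmax J m \<beta> j (x u) * (\<beta> * x' j))"
    by (simp add: S'_def softmax_def S_def[symmetric] sum_divide_distrib)
  moreover have "softmax J m \<beta> i (x u) * (\<beta> * x' i) = (\<Sum>j\<in>J. x' j * (\<beta> * (softmax J m \<beta> i (x u) * of_bool (i = j))))"
    using J assms(2) by (simp add: of_bool_def if_distrib mult_ac cong: if_cong)
  ultimately show ?thesis
    by (simp add: right_diff_distrib sum_subtractf sum_distrib_left mult_ac)
qed

lemma log_sum_exp_has_derivative:
  assumes "\<And>k. k \<in> J \<Longrightarrow> ((\<lambda>u. x u k) has_real_derivative x' k) (at u)"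
  shows "((\<lambda>u. log_sum_exp J m \<beta> (x u)) has_real_derivative (\<Sum>j\<in>J. x' j * softmax J m \<beta> j (x u))) (at u)"
proof -
  define S where "S = (\<Sum>k\<in>J. exp (\<beta> * (x u k + m k)))"
  define S' where "S' = (\<Sum>k\<in>J. exp (\<beta> * (x u k + m k)) * (\<beta> * x' k))"
  have S: "S > 0" unfolding S_def by (rule sum_exp_pos)
  have "((\<lambda>u. \<Sum>k\<in>J. exp (\<beta> * (x u k + m k))) has_real_derivative S') (at u)"
    unfolding S'_def using assms by (auto intro!: derivative_eq_intros simp: mult_ac)
  then have "((\<lambda>u. ln (\<Sum>k\<in>J. exp (\<beta> * (x u k + m k)))) has_real_derivative 1 / S * S') (at u)"
    using DERIV_chain2[where g = "\<lambda>u. \<Sum>k\<in>J. exp (\<beta> * (x u k + m k))", OF DERIV_ln_divide] S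
    by (simp add: S_def)
  then have "((\<lambda>u. log_sum_exp J m \<beta> (x u)) has_real_derivative 1 / S * S' / \<beta>) (at u)"
    unfolding log_sum_exp_def by (rule DERIV_cdivide)
  moreover have "1 / S * S' / \<beta> = (\<Sum>j\<in>J. x' j * softmax J m \<beta> j (x u))"
    using \<beta> by (simp add: S'_def softmax_def S_def[symmetric] sum_divide_distrib mult_ac)
  ultimately show ?thesis by simp
qed

lemma Max_le_log_sum_exp: "Max ((\<lambda>k. x k + m k) ` J) \<le> log_sum_exp J m \<beta> x"
proof -
  have "x k + m k \<le> log_sum_exp J m \<beta> x" if "k \<in> J" for k
  proof -
    have "exp (\<beta> * (x k + m k)) \<le> (\<Sum>k\<in>J. exp (\<beta> * (x k + m k)))"
      using J that by (intro member_le_sum) auto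
    then have "\<beta> * (x k + m k) \<le> ln (\<Sum>k\<in>J. exp (\<beta> * (x k + m k)))"
      using sum_exp_pos[of x] by (simp add: ln_ge_iff)
    then show ?thesis using \<beta> by (simp add: log_sum_exp_def pos_le_divide_eq mult.commute)
  qed
  then show ?thesis using J by simp
qed

lemma log_sum_exp_le_Max: "log_sum_exp J m \<beta> x \<le> Max ((\<lambda>k. x k + m k) ` J) + ln (real (card J)) / \<beta>"
proof -
  define M where "M = Max ((\<lambda>k. x k + m k) ` J)"
  have c: "real (card J) > 0" using J by (simp add: card_gt_0_iff)
  have "(\<Sum>k\<in>J. exp (\<beta> * (x k + m k))) \<le> (\<Sum>k\<in>J. exp (\<beta> * M))"
    using J \<beta> by (intro sum_mono) (simp add: M_def)
  then have "ln (\<Sum>k\<in>J. exp (\<beta> * (x k + m k))) \<le> ln (real (card J) * exp (\<beta> * M))"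
    using sum_exp_pos[of x] by (intro ln_mono) auto
  also have "\<dots> = ln (real (card J)) + \<beta> * M" using c by (simp add: ln_mult)
  finally have "log_sum_exp J m \<beta> x \<le> (ln (real (card J)) + \<beta> * M) / \<beta>"
    using \<beta> unfolding log_sum_exp_def by (intro divide_right_mono) auto
  then show ?thesis using \<beta> by (simp add: M_def add_divide_distrib)
qed

lemma abs_log_sum_exp_le: "\<bar>log_sum_exp J m \<beta> x\<bar> \<le> (\<Sum>k\<in>J. \<bar>x k\<bar> + \<bar>m k\<bar>) + ln (real (card J)) / \<beta>"
proof -
  have "Max ((\<lambda>k. x k + m k) ` J) \<in> (\<lambda>k. x k + m k) ` J"
    using J by (intro Max_in) auto
  then obtain k where k: "k \<in> J" "Max ((\<lambda>k. x k + m k) ` J) = x k + m k" by (rule imageE)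
  have "\<bar>x k + m k\<bar> \<le> \<bar>x k\<bar> + \<bar>m k\<bar>" by simp
  also have "\<dots> \<le> (\<Sum>k\<in>J. \<bar>x k\<bar> + \<bar>m k\<bar>)"
    using J k by (intro member_le_sum) auto
  moreover have "0 \<le> ln (real (card J)) / \<beta>" using J \<beta> by (simp add: Suc_le_eq card_gt_0_iff)
  ultimately show ?thesis using Max_le_log_sum_exp[of x] log_sum_exp_le_Max[of x] unfolding k(2) by linarith
qed

end

text \<open>Since \<open>p\<close> sums to 1, the matrix
  \<open>p i * of_bool (i = j) - p i * p j\<close> has zero row and column sums. The pairing with
  \<open>d\<close> therefore equals half the sum of
  \<open>p i * p j * (d i i + d j j - 2 * d i j)\<close>. For a difference \<open>d\<close> of
  covariances these brackets are differences of increment variances.\<close>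

lemma sum_mult_diag_ge:
  fixes p :: "'i \<Rightarrow> real"
  assumes J: "finite J" and p: "\<And>i. i \<in> J \<Longrightarrow> 0 \<le> p i" "sum p J = 1"
    and d: "\<And>i j. i \<in> J \<Longrightarrow> j \<in> J \<Longrightarrow> 0 \<le> d i i + d j j - 2 * d i j"
  shows "0 \<le> (\<Sum>i\<in>J. \<Sum>j\<in>J. d i j * (p i * of_bool (i = j) - p i * p j))"
proof -
  have "0 \<le> (\<Sum>i\<in>J. \<Sum>j\<in>J. p i * p j * (d i i + d j j - 2 * d i j))"
    using p d by (intro sum_nonneg mult_nonneg_nonneg) auto
  also have "\<dots> = (\<Sum>i\<in>J. \<Sum>j\<in>J. p i * d i i * p j) + (\<Sum>i\<in>J. \<Sum>j\<in>J. p i * (p j * d j j)) - 2 * (\<Sum>i\<in>J. \<Sum>j\<in>J. d i j * (p i * p j))"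
    by (simp add: sum.distrib sum_subtractf sum_distrib_left algebra_simps)
  also have "(\<Sum>i\<in>J. \<Sum>j\<in>J. p i * d i i * p j) = (\<Sum>i\<in>J. p i * d i i)"
    using p(2) by (simp flip: sum_distrib_left)
  also have "(\<Sum>i\<in>J. \<Sum>j\<in>J. p i * (p j * d j j)) = (\<Sum>i\<in>J. p i * d i i)"
    using p(2) by (simp flip: sum_distrib_left sum_distrib_right)
  also have "(\<Sum>i\<in>J. p i * d i i) = (\<Sum>i\<in>J. \<Sum>j\<in>J. d i j * (p i * of_bool (i = j)))"
    using J by (simp add: of_bool_def if_distrib mult_ac cong: if_cong)
  finally show ?thesis by (simp add: right_diff_distrib sum_subtractf)
qed

section \<open>Finite Gaussian families\<close>

text \<open>Stated through characteristic functions, the notion passes directly to independent sums and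
  covers degenerate covariances.\<close>

definition gauss_family :: "'a measure \<Rightarrow> 'i set \<Rightarrow> ('i \<Rightarrow> 'a \<Rightarrow> real) \<Rightarrow> bool" where
  "gauss_family M I X \<longleftrightarrow> prob_space M \<and>
    (\<forall>t\<in>I. X t \<in> borel_measurable M \<and> integrable M (\<lambda>x. (X t x)\<^sup>2) \<and> (LINT x|M. X t x) = 0) \<and>
    (\<forall>J b. finite J \<longrightarrow> J \<subseteq> I \<longrightarrow> (CLINT x|M. iexp (\<Sum>t\<in>J. b t * X t x)) =
       complex_of_real (exp (- (LINT x|M. (\<Sum>t\<in>J. b t * X t x)\<^sup>2) / 2)))"

lemma gauss_familyD:
  assumes "gauss_family M I X"
  shows "prob_space M"
    and "\<And>t. t \<in> I \<Longrightarrow> X t \<in> borel_measurable M"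
    and "\<And>t. t \<in> I \<Longrightarrow> integrable M (\<lambda>x. (X t x)\<^sup>2)"
    and "\<And>t. t \<in> I \<Longrightarrow> (LINT x|M. X t x) = 0"
    and "\<And>J b. finite J \<Longrightarrow> J \<subseteq> I \<Longrightarrow> (CLINT x|M. iexp (\<Sum>t\<in>J. b t * X t x)) =
       complex_of_real (exp (- (LINT x|M. (\<Sum>t\<in>J. b t * X t x)\<^sup>2) / 2))"
    and "\<And>s t. s \<in> I \<Longrightarrow> t \<in> I \<Longrightarrow> integrable M (\<lambda>x. X s x * X t x)"
    and "\<And>t. t \<in> I \<Longrightarrow> integrable M (X t)"
proof -
  show P: "prob_space M"
    and X: "\<And>t. t \<in> I \<Longrightarrow> X t \<in> borel_measurable M"
    and sq: "\<And>t. t \<in> I \<Longrightarrow> integrable M (\<lambda>x. (X t x)\<^sup>2)"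
    and "\<And>t. t \<in> I \<Longrightarrow> (LINT x|M. X t x) = 0"
    and "\<And>J b. finite J \<Longrightarrow> J \<subseteq> I \<Longrightarrow> (CLINT x|M. iexp (\<Sum>t\<in>J. b t * X t x)) =
       complex_of_real (exp (- (LINT x|M. (\<Sum>t\<in>J. b t * X t x)\<^sup>2) / 2))"
    using assms unfolding gauss_family_def by blast+
  show "integrable M (\<lambda>x. X s x * X t x)" if "s \<in> I" "t \<in> I" for s t
    using X sq that by (intro integrable_square_mult) auto
  interpret prob_space M by fact
  show "integrable M (X t)" if "t \<in> I" for t
    using integrable_square_mult[of "X t" M "\<lambda>_. 1"] X sq that by simp
qed

lemma gauss_family_subset: "gauss_family M I X \<Longrightarrow> J \<subseteq> I \<Longrightarrow> gauss_family M J X"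
  unfolding gauss_family_def by (auto 4 4)

text \<open>Isolates how the variance of a linear combination depends on the extra coefficient
  \<open>r\<close> of one coordinate. The linear and the quadratic term become the covariance and
  the variance in the characteristic-function hypothesis of the integration by parts.\<close>

lemma gauss_family_integral_square:
  assumes X: "gauss_family M I X" and J: "finite J" "J \<subseteq> I" and i: "i \<in> I"
  shows "(LINT x|M. ((\<Sum>j\<in>J. b j * X j x) + r * X i x)\<^sup>2) =
    (LINT x|M. (\<Sum>j\<in>J. b j * X j x)\<^sup>2) + 2 * r * (\<Sum>j\<in>J. b j * (LINT x|M. X j x * X i x)) + r\<^sup>2 * (LINT x|M. (X i x)\<^sup>2)"
proof -
  note [simp] = gauss_familyD(6)[OF X] gauss_familyD(3)[OF X]
  have JI: "j \<in> J \<Longrightarrow> j \<in> I" for j using J by auto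
  have "((\<Sum>j\<in>J. b j * X j x) + r * X i x)\<^sup>2 = (\<Sum>j\<in>J. b j * X j x)\<^sup>2 +
      ((\<Sum>j\<in>J. 2 * r * b j * (X j x * X i x)) + r\<^sup>2 * (X i x)\<^sup>2)" for x
    by (simp add: power2_eq_square algebra_simps sum_distrib_left sum_distrib_right)
  moreover have "integrable M (\<lambda>x. (\<Sum>j\<in>J. b j * X j x)\<^sup>2)"
  proof -
    have "(\<Sum>j\<in>J. b j * X j x)\<^sup>2 = (\<Sum>j\<in>J. \<Sum>k\<in>J. b j * b k * (X j x * X k x))" for x
      by (simp add: power2_eq_square sum_product mult_ac)
    then show ?thesis using JI by simp
  qed
  moreover have "(LINT x|M. ((\<Sum>j\<in>J. 2 * r * b j * (X j x * X i x)) + r\<^sup>2 * (X i x)\<^sup>2)) =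
      2 * r * (\<Sum>j\<in>J. b j * (LINT x|M. X j x * X i x)) + r\<^sup>2 * (LINT x|M. (X i x)\<^sup>2)"
    using JI i by (simp add: sum_distrib_left mult_ac)
  moreover have "integrable M (\<lambda>x. (\<Sum>j\<in>J. 2 * r * b j * (X j x * X i x)) + r\<^sup>2 * (X i x)\<^sup>2)"
    using JI i by simp
  ultimately show ?thesis by simp
qed

lemma integral_square_diff:
  fixes f g :: "'a \<Rightarrow> real"
  assumes "integrable M (\<lambda>x. (f x)\<^sup>2)" "integrable M (\<lambda>x. (g x)\<^sup>2)" "integrable M (\<lambda>x. f x * g x)"
  shows "(LINT x|M. (f x - g x)\<^sup>2) = (LINT x|M. (f x)\<^sup>2) + (LINT x|M. (g x)\<^sup>2) - 2 * (LINT x|M. f x * g x)"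
proof -
  have "(f x - g x)\<^sup>2 = (f x)\<^sup>2 + (g x)\<^sup>2 - 2 * (f x * g x)" for x
    by (simp add: power2_eq_square algebra_simps)
  then show ?thesis using assms by simp
qed

section \<open>Interpolation between two independent Gaussian families\<close>

text \<open>The derivative along the path is \<open>sin t * cos t\<close> times the expected pairing
  of the covariance difference with the Hessian of \<open>log_sum_exp\<close>, whose sign follows
  from \<open>sum_mult_diag_ge\<close>. The circular path keeps the velocity \<open>Z'\<close>
  dominated up to the endpoints, where square-root weights would have unbounded derivatives.\<close>

lemma expectation_log_sum_exp_mono:
  fixes X :: "'i \<Rightarrow> 'a \<Rightarrow> real" and Y :: "'i \<Rightarrow> 'b \<Rightarrow> real"
  assumes J: "finite J" "J \<noteq> {}" and \<beta>: "\<beta> > 0"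
    and X: "gauss_family M J X" and Y: "gauss_family N J Y"
    and le: "\<And>i j. i \<in> J \<Longrightarrow> j \<in> J \<Longrightarrow> (LINT x|M. (X i x - X j x)\<^sup>2) \<le> (LINT y|N. (Y i y - Y j y)\<^sup>2)"
  shows "(LINT x|M. log_sum_exp J m \<beta> (\<lambda>j. X j x)) \<le> (LINT y|N. log_sum_exp J m \<beta> (\<lambda>j. Y j y))"
proof -
  interpret M: prob_space M using X by (rule gauss_familyD)
  interpret N: prob_space N using Y by (rule gauss_familyD)
  interpret P: pair_prob_space M N ..
  note X_meas[measurable] = gauss_familyD(2)[OF X] and Y_meas[measurable] = gauss_familyD(2)[OF Y]
  define P where "P = M \<Otimes>\<^sub>M N"
  have fst_snd[measurable]: "fst \<in> P \<rightarrow>\<^sub>M M" "snd \<in> P \<rightarrow>\<^sub>M N" by (simp_all add: P_def)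
  have P: "prob_space P" unfolding P_def by unfold_locales
  interpret Q: prob_space P by fact
  have dM: "distr P M fst = M" unfolding P_def by (rule N.distr_pair_fst)
  have dN: "distr P N snd = N" unfolding P_def by (rule distr_pair_snd[OF M.prob_space_axioms N.prob_space_axioms])
  have intM: "integrable P (\<lambda>z. f (fst z)) \<longleftrightarrow> integrable M f" "(LINT z|P. f (fst z)) = (LINT x|M. f x)"
    if [measurable]: "f \<in> borel_measurable M" for f :: "'a \<Rightarrow> real"
    using integrable_distr_eq[of fst P M f] integral_distr[of fst P M f] by (simp_all add: dM)
  have intN: "integrable P (\<lambda>z. f (snd z)) \<longleftrightarrow> integrable N f" "(LINT z|P. f (snd z)) = (LINT x|N. f x)"
    if [measurable]: "f \<in> borel_measurable N" for f :: "'b \<Rightarrow> real"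
    using integrable_distr_eq[of snd P N f] integral_distr[of snd P N f] by (simp_all add: dN)
  define sx where "sx i j = (LINT x|M. X i x * X j x)" for i j
  define sy where "sy i j = (LINT x|N. Y i x * Y j x)" for i j
  define Z where "Z t j z = cos t * X j (fst z) + sin t * Y j (snd z)" for t j z
  define Z' where "Z' t j z = - sin t * X j (fst z) + cos t * Y j (snd z)" for t j z
  define p where "p i = softmax J m \<beta> i" for i
  define D where "D i j x = \<beta> * (p i x * of_bool (i = j) - p i x * p j x)" for i j x
  \<comment> \<open>The covariance of \<open>Z' t i\<close> and \<open>Z t j\<close>; mixed terms
    are absent because \<open>X\<close> and \<open>Y\<close> are read from independent factors and
    centered.\<close>
  define c where "c t i j = sin t * cos t * (sy j i - sx j i)" for t i j
  have Z_meas[measurable]: "j \<in> J \<Longrightarrow> Z t j \<in> borel_measurable P" "j \<in> J \<Longrightarrow> Z' t j \<in> borel_measurable P" for t j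
    unfolding Z_def Z'_def by measurable
  have pair_char: "(CLINT z|P. iexp ((\<Sum>j\<in>J. b j * X j (fst z)) + (\<Sum>j\<in>J. b' j * Y j (snd z)))) =
      complex_of_real (exp (- (LINT x|M. (\<Sum>j\<in>J. b j * X j x)\<^sup>2) / 2 - (LINT x|N. (\<Sum>j\<in>J. b' j * Y j x)\<^sup>2) / 2))" for b b'
  proof -
    have "(CLINT z|P. iexp ((\<Sum>j\<in>J. b j * X j (fst z)) + (\<Sum>j\<in>J. b' j * Y j (snd z)))) =
        (CLINT z|P. (\<lambda>(x, y). iexp (\<Sum>j\<in>J. b j * X j x) * iexp (\<Sum>j\<in>J. b' j * Y j y)) z)"
      by (auto simp: distrib_left exp_add intro!: Bochner_Integration.integral_cong)
    also have "\<dots> = (CLINT x|M. CLINT y|N. iexp (\<Sum>j\<in>J. b j * X j x) * iexp (\<Sum>j\<in>J. b' j * Y j y))"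
      unfolding P_def
      by (subst P.integral_fst'[symmetric])
         (auto intro!: integrable_if_norm_bounded[where C = 1] P.finite_measure_axioms simp: norm_mult)
    also have "\<dots> = complex_of_real (exp (- (LINT x|M. (\<Sum>j\<in>J. b j * X j x)\<^sup>2) / 2)) *
        complex_of_real (exp (- (LINT x|N. (\<Sum>j\<in>J. b' j * Y j x)\<^sup>2) / 2))"
      by (simp only: integral_mult_right_zero integral_mult_left_zero
          gauss_familyD(5)[OF X J(1) order.refl] gauss_familyD(5)[OF Y J(1) order.refl])
    also have "\<dots> = complex_of_real (exp (- (LINT x|M. (\<Sum>j\<in>J. b j * X j x)\<^sup>2) / 2 + - (LINT x|N. (\<Sum>j\<in>J. b' j * Y j x)\<^sup>2) / 2))"
      by (simp only: exp_add of_real_mult)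
    finally show ?thesis by (simp only: minus_divide_left diff_conv_add_uminus)
  qed
  have char: "(CLINT z|P. iexp (s * Z' t i z + (\<Sum>j\<in>J. b j * Z t j z))) =
      complex_of_real (exp (- (((sin t)\<^sup>2 * sx i i + (cos t)\<^sup>2 * sy i i) * s\<^sup>2 / 2) - s * (\<Sum>j\<in>J. b j * c t i j))) *
      (CLINT z|P. iexp (\<Sum>j\<in>J. b j * Z t j z))" if i: "i \<in> J" for t i s b
  proof -
    \<comment> \<open>The coefficients of \<open>X\<close> and of \<open>Y\<close> in
      \<open>s * Z' t i\<close> plus the combination of the \<open>Z t j\<close>; the velocity adds
      an extra amount at the index \<open>i\<close> only.\<close>
    define bx where "bx j = cos t * b j + (- sin t * s) * of_bool (j = i)" for j
    define bY where "bY j = sin t * b j + (cos t * s) * of_bool (j = i)" for j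
    have bx: "(\<Sum>j\<in>J. bx j * f j) = (\<Sum>j\<in>J. (cos t * b j) * f j) + (- sin t * s) * f i"
      and bY: "(\<Sum>j\<in>J. bY j * f j) = (\<Sum>j\<in>J. (sin t * b j) * f j) + (cos t * s) * f i" for f :: "'i \<Rightarrow> real"
      unfolding bx_def bY_def using J i
      by (simp_all add: distrib_right sum.distrib of_bool_def if_distrib[of "\<lambda>x. _ * x"] if_distrib[of "\<lambda>x. x * _"] cong: if_cong)
    have e1: "s * Z' t i z + (\<Sum>j\<in>J. b j * Z t j z) = (\<Sum>j\<in>J. bx j * X j (fst z)) + (\<Sum>j\<in>J. bY j * Y j (snd z))" for z
      unfolding bx bY by (simp add: Z_def Z'_def algebra_simps sum.distrib sum_distrib_left)
    have e2: "(\<Sum>j\<in>J. b j * Z t j z) = (\<Sum>j\<in>J. cos t * b j * X j (fst z)) + (\<Sum>j\<in>J. sin t * b j * Y j (snd z))" for z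
      by (simp add: Z_def algebra_simps sum.distrib sum_distrib_left)
    have qx: "(LINT x|M. (\<Sum>j\<in>J. bx j * X j x)\<^sup>2) = (LINT x|M. (\<Sum>j\<in>J. cos t * b j * X j x)\<^sup>2)
        + 2 * (- sin t * s) * (\<Sum>j\<in>J. cos t * b j * sx j i) + (- sin t * s)\<^sup>2 * sx i i"
      unfolding bx by (subst gauss_family_integral_square[OF X J(1) order.refl i]) (simp add: sx_def power2_eq_square)
    have qy: "(LINT x|N. (\<Sum>j\<in>J. bY j * Y j x)\<^sup>2) = (LINT x|N. (\<Sum>j\<in>J. sin t * b j * Y j x)\<^sup>2)
        + 2 * (cos t * s) * (\<Sum>j\<in>J. sin t * b j * sy j i) + (cos t * s)\<^sup>2 * sy i i"
      unfolding bY by (subst gauss_family_integral_square[OF Y J(1) order.refl i]) (simp add: sy_def power2_eq_square)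
    have cs: "(\<Sum>j\<in>J. b j * c t i j) = cos t * (\<Sum>j\<in>J. sin t * b j * sy j i) - sin t * (\<Sum>j\<in>J. cos t * b j * sx j i)"
      unfolding c_def by (simp add: sum_distrib_left sum_subtractf algebra_simps)
    have ex: "- (LINT x|M. (\<Sum>j\<in>J. bx j * X j x)\<^sup>2) / 2 - (LINT x|N. (\<Sum>j\<in>J. bY j * Y j x)\<^sup>2) / 2 =
       (- (((sin t)\<^sup>2 * sx i i + (cos t)\<^sup>2 * sy i i) * s\<^sup>2 / 2) - s * (\<Sum>j\<in>J. b j * c t i j)) +
       (- (LINT x|M. (\<Sum>j\<in>J. cos t * b j * X j x)\<^sup>2) / 2 - (LINT x|N. (\<Sum>j\<in>J. sin t * b j * Y j x)\<^sup>2) / 2)"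
      unfolding qx qy cs by (simp add: power_mult_distrib algebra_simps add_divide_distrib diff_divide_distrib)
    have "(CLINT z|P. iexp (s * Z' t i z + (\<Sum>j\<in>J. b j * Z t j z))) = complex_of_real
        (exp (- (LINT x|M. (\<Sum>j\<in>J. bx j * X j x)\<^sup>2) / 2 - (LINT x|N. (\<Sum>j\<in>J. bY j * Y j x)\<^sup>2) / 2))"
      unfolding e1 pair_char ..
    moreover have "(CLINT z|P. iexp (\<Sum>j\<in>J. b j * Z t j z)) = complex_of_real
        (exp (- (LINT x|M. (\<Sum>j\<in>J. cos t * b j * X j x)\<^sup>2) / 2 - (LINT x|N. (\<Sum>j\<in>J. sin t * b j * Y j x)\<^sup>2) / 2))"
      unfolding e2 pair_char ..
    ultimately show ?thesis
      unfolding ex by (simp only: exp_add of_real_mult)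
  qed
  have p_bnd: "0 \<le> p i x" "i \<in> J \<Longrightarrow> p i x \<le> 1" "i \<in> J \<Longrightarrow> \<bar>p i x\<bar> \<le> 1" for i x
    using softmax_nonneg[OF J \<beta>, of m i x] softmax_le_1[OF J \<beta>, of i m x] by (auto simp: p_def)
  have p_sum: "(\<Sum>i\<in>J. p i x) = 1" for x unfolding p_def by (rule sum_softmax[OF J \<beta>])
  have p_meas: "p i \<in> borel_measurable (Pi\<^sub>M J (\<lambda>_. borel))" if [measurable]: "i \<in> J" for i
    unfolding p_def softmax_def by measurable
  have p_restr: "p i (restrict x J) = p i x" if "i \<in> J" for i x
    using that by (simp add: p_def softmax_def)
  have D_bnd: "\<bar>D i j x\<bar> \<le> 1 + 2 * \<beta>" if "i \<in> J" "j \<in> J" for i j x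
  proof -
    have "0 \<le> p i x * p j x" "p i x * p j x \<le> 1"
      using p_bnd[of i x] p_bnd[of j x] that by (auto intro: mult_le_one)
    moreover have "0 \<le> p i x * of_bool (i = j)" "p i x * of_bool (i = j) \<le> 1"
      using p_bnd[of i x] that by (auto simp: of_bool_def)
    ultimately have "\<bar>p i x * of_bool (i = j) - p i x * p j x\<bar> \<le> 2" by linarith
    then have "\<bar>D i j x\<bar> \<le> \<beta> * 2" unfolding D_def abs_mult using \<beta> by (intro mult_mono) auto
    then show ?thesis by simp
  qed
  have p_Z_meas[measurable]: "(\<lambda>z. p i (\<lambda>j. Z t j z)) \<in> borel_measurable P" if [measurable]: "i \<in> J" for i t
    unfolding p_def softmax_def by measurable
  have D_Z_meas[measurable]: "(\<lambda>z. D i j (\<lambda>j. Z t j z)) \<in> borel_measurable P" if [measurable]: "i \<in> J" "j \<in> J" for i j t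
    unfolding D_def by measurable
  have iX: "integrable P (\<lambda>z. X i (fst z))" and iY: "integrable P (\<lambda>z. Y i (snd z))" if "i \<in> J" for i
    using that gauss_familyD(2,7)[OF X] gauss_familyD(2,7)[OF Y] intM[of "X i"] intN[of "Y i"] by auto
  have iZ': "integrable P (Z' t i)" if "i \<in> J" for t i
    unfolding Z'_def using iX[OF that] iY[OF that] by auto
  have ibp: "(LINT z|P. Z' t i z * p i (\<lambda>j. Z t j z)) = (\<Sum>j\<in>J. c t i j * (LINT z|P. D i j (\<lambda>j. Z t j z)))" if i: "i \<in> J" for t i
  proof (cases "(sin t)\<^sup>2 * sx i i + (cos t)\<^sup>2 * sy i i > 0")
    case True
    show ?thesis
    proof (rule Q.gaussian_integration_by_parts[OF J(1) _ iZ'[OF i] _ True char[OF i] p_meas[OF i], where C = "1 + 2 * \<beta>"])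
      show "D i j \<in> borel_measurable (Pi\<^sub>M J (\<lambda>_. borel))" if "j \<in> J" for j
        unfolding D_def using p_meas i that by measurable
      show "D i j (restrict x J) = D i j x" if "j \<in> J" for j x using i that by (simp add: D_def p_restr)
      show "\<bar>p i x\<bar> \<le> 1 + 2 * \<beta>" for x using p_bnd(3)[OF i, of x] \<beta> by simp
      have p_deriv: "((\<lambda>u. p k (\<lambda>j. a j * u + r j)) has_real_derivative
          (\<Sum>j\<in>J. a j * D k j (\<lambda>j. a j * u + r j))) (at u)" if "k \<in> J" for a r u k
        unfolding p_def D_def using that
        by (intro softmax_has_derivative[OF J \<beta>]) (auto intro!: derivative_eq_intros)
      then show "((\<lambda>u. p i (\<lambda>j. a j * u + r j)) has_real_derivative
          (\<Sum>j\<in>J. a j * D i j (\<lambda>j. a j * u + r j))) (at u)" for a r u using i by blast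
      show "isCont (\<lambda>u. D i j (\<lambda>j. a j * u + r j)) u" if "j \<in> J" for a r u j
        unfolding D_def using DERIV_isCont[OF p_deriv] i that by (intro continuous_intros) auto
    qed (use i p_restr D_bnd in auto)
  next
    \<comment> \<open>The integration by parts demands a positive variance of the velocity. If this
      variance is zero, both of its components vanish almost everywhere, hence also the covariances
      \<open>c t i j\<close>, and both sides are zero. Coordinates of variance zero, such as time
      \<open>0\<close> of the processes, lead here.\<close>
    case False
    have nn: "0 \<le> sx i i" "0 \<le> sy i i" by (simp_all add: sx_def sy_def)
    then have "0 \<le> (sin t)\<^sup>2 * sx i i" "0 \<le> (cos t)\<^sup>2 * sy i i" by simp_all
    then have "(sin t)\<^sup>2 * sx i i = 0" "(cos t)\<^sup>2 * sy i i = 0" using False by linarith+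
    then have z: "sin t = 0 \<or> sx i i = 0" "cos t = 0 \<or> sy i i = 0" by auto
    have X0: "AE x in M. sin t * X i x = 0"
    proof (cases "sin t = 0")
      case False
      then have "(LINT x|M. (X i x)\<^sup>2) = 0" using z by (simp add: sx_def power2_eq_square)
      then have "AE x in M. (X i x)\<^sup>2 = 0"
        using gauss_familyD(3)[OF X i] by (subst (asm) integral_nonneg_eq_0_iff_AE) auto
      then show ?thesis by auto
    qed simp
    have Y0: "AE x in N. cos t * Y i x = 0"
    proof (cases "cos t = 0")
      case False
      then have "(LINT x|N. (Y i x)\<^sup>2) = 0" using z by (simp add: sy_def power2_eq_square)
      then have "AE x in N. (Y i x)\<^sup>2 = 0"
        using gauss_familyD(3)[OF Y i] by (subst (asm) integral_nonneg_eq_0_iff_AE) auto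
      then show ?thesis by auto
    qed simp
    have "AE z in P. sin t * X i (fst z) = 0"
      using AE_distrD[OF fst_snd(1), of "\<lambda>x. sin t * X i x = 0"] X0 by (simp only: dM)
    moreover have "AE z in P. cos t * Y i (snd z) = 0"
      using AE_distrD[OF fst_snd(2), of "\<lambda>x. cos t * Y i x = 0"] Y0 by (simp only: dN)
    ultimately have "AE z in P. Z' t i z = 0" unfolding Z'_def by eventually_elim auto
    then have "(LINT z|P. Z' t i z * p i (\<lambda>j. Z t j z)) = (LINT z|P. 0)"
      using i by (intro integral_cong_AE) auto
    moreover have "c t i j = 0" if "j \<in> J" for j
    proof -
      have "sin t * sx j i = (LINT x|M. X j x * (sin t * X i x))" by (simp add: sx_def mult_ac)
      also have "\<dots> = (LINT x|M. 0)" using X0 that i by (intro integral_cong_AE) auto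
      finally have 1: "sin t * sx j i = 0" by simp
      have "cos t * sy j i = (LINT x|N. Y j x * (cos t * Y i x))" by (simp add: sy_def mult_ac)
      also have "\<dots> = (LINT x|N. 0)" using Y0 that i by (intro integral_cong_AE) auto
      finally have 2: "cos t * sy j i = 0" by simp
      show ?thesis unfolding c_def using 1 2 by auto
    qed
    ultimately show ?thesis by simp
  qed
  define \<phi> where "\<phi> t = (LINT z|P. log_sum_exp J m \<beta> (\<lambda>j. Z t j z))" for t
  define \<phi>' where "\<phi>' t = (LINT z|P. (\<Sum>i\<in>J. Z' t i z * p i (\<lambda>j. Z t j z)))" for t
  \<comment> \<open>An envelope independent of \<open>t\<close>: sine and cosine are at most 1 in
    absolute value, so it dominates the derivative and, up to a constant, the integrand.\<close>
  define w where "w z = (\<Sum>i\<in>J. \<bar>X i (fst z)\<bar> + \<bar>Y i (snd z)\<bar>)" for z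
  have w: "integrable P w" unfolding w_def using iX iY by auto
  have Z_le: "\<bar>Z t i z\<bar> \<le> \<bar>X i (fst z)\<bar> + \<bar>Y i (snd z)\<bar>" "\<bar>Z' t i z\<bar> \<le> \<bar>X i (fst z)\<bar> + \<bar>Y i (snd z)\<bar>" for t i z
    unfolding Z_def Z'_def
    by (intro order.trans[OF abs_triangle_ineq] add_mono; simp add: abs_mult mult_left_le_one_le)+
  have lse_meas[measurable]: "(\<lambda>z. log_sum_exp J m \<beta> (\<lambda>j. Z t j z)) \<in> borel_measurable P" for t
    unfolding log_sum_exp_def by measurable
  have lse_int: "integrable P (\<lambda>z. log_sum_exp J m \<beta> (\<lambda>j. Z t j z))" for t
  proof (rule Bochner_Integration.integrable_bound)
    show "integrable P (\<lambda>z. w z + ((\<Sum>k\<in>J. \<bar>m k\<bar>) + ln (real (card J)) / \<beta>))" using w by simp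
    have "\<bar>log_sum_exp J m \<beta> (\<lambda>j. Z t j z)\<bar> \<le> w z + ((\<Sum>k\<in>J. \<bar>m k\<bar>) + ln (real (card J)) / \<beta>)" for z
    proof -
      have "\<bar>log_sum_exp J m \<beta> (\<lambda>j. Z t j z)\<bar> \<le> (\<Sum>k\<in>J. \<bar>Z t k z\<bar> + \<bar>m k\<bar>) + ln (real (card J)) / \<beta>"
        by (rule abs_log_sum_exp_le[OF J \<beta>])
      also have "(\<Sum>k\<in>J. \<bar>Z t k z\<bar> + \<bar>m k\<bar>) \<le> w z + (\<Sum>k\<in>J. \<bar>m k\<bar>)"
        unfolding w_def sum.distrib[of "\<lambda>k. \<bar>Z t k z\<bar>"] using Z_le by (intro add_right_mono sum_mono) auto
      finally show ?thesis by simp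
    qed
    then show "AE z in P. norm (log_sum_exp J m \<beta> (\<lambda>j. Z t j z)) \<le> norm (w z + ((\<Sum>k\<in>J. \<bar>m k\<bar>) + ln (real (card J)) / \<beta>))"
      by (auto intro!: AE_I2 order.trans[OF _ abs_ge_self])
  qed measurable
  have d\<phi>: "(\<phi> has_real_derivative \<phi>' t) (at t)" for t
    unfolding \<phi>_def \<phi>'_def
  proof (rule has_derivative_expectation[OF lse_int _ _ _ w])
    show "((\<lambda>t. log_sum_exp J m \<beta> (\<lambda>j. Z t j z)) has_real_derivative (\<Sum>i\<in>J. Z' t i z * p i (\<lambda>j. Z t j z))) (at t)" for t z
      unfolding p_def
      by (rule log_sum_exp_has_derivative[OF J \<beta>]) (auto simp: Z_def Z'_def intro!: derivative_eq_intros)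
    show "\<bar>\<Sum>i\<in>J. Z' t i z * p i (\<lambda>j. Z t j z)\<bar> \<le> w z" for t z
    proof -
      have "\<bar>Z' t i z * p i (\<lambda>j. Z t j z)\<bar> \<le> (\<bar>X i (fst z)\<bar> + \<bar>Y i (snd z)\<bar>) * 1" if "i \<in> J" for i
        unfolding abs_mult using that p_bnd(3) Z_le by (intro mult_mono) auto
      then show ?thesis unfolding w_def by (intro order.trans[OF sum_abs] sum_mono) simp
    qed
  qed measurable
  have \<phi>'_nonneg: "0 \<le> \<phi>' t" if t: "0 \<le> t" "t \<le> pi / 2" for t
  proof -
    have iD: "integrable P (\<lambda>z. D i j (\<lambda>j. Z t j z))" if "i \<in> J" "j \<in> J" for i j
      using D_bnd that by (intro integrable_if_norm_bounded[where C = "1 + 2 * \<beta>"] Q.finite_measure_axioms) auto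
    have "\<phi>' t = (\<Sum>i\<in>J. (LINT z|P. Z' t i z * p i (\<lambda>j. Z t j z)))"
      unfolding \<phi>'_def using iZ' p_bnd(3)
      by (intro Bochner_Integration.integral_sum integrable_mult_bounded[where C = 1]) auto
    also have "\<dots> = (\<Sum>i\<in>J. \<Sum>j\<in>J. c t i j * (LINT z|P. D i j (\<lambda>j. Z t j z)))"
      using ibp by simp
    also have "\<dots> = (LINT z|P. (\<Sum>i\<in>J. \<Sum>j\<in>J. c t i j * D i j (\<lambda>j. Z t j z)))"
      using iD by simp
    also have "\<dots> \<ge> 0"
    proof (rule Bochner_Integration.integral_nonneg)
      fix z
      define d where "d i j = sy j i - sx j i" for i j
      have "0 \<le> (\<Sum>i\<in>J. \<Sum>j\<in>J. d i j * (p i (\<lambda>j. Z t j z) * of_bool (i = j) - p i (\<lambda>j. Z t j z) * p j (\<lambda>j. Z t j z)))"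
      proof (rule sum_mult_diag_ge[OF J(1)])
        fix i j assume ij: "i \<in> J" "j \<in> J"
        have "(LINT x|M. (X i x - X j x)\<^sup>2) = sx i i + sx j j - 2 * sx j i"
          using gauss_familyD(3,6)[OF X] ij
          by (subst integral_square_diff) (auto simp: sx_def power2_eq_square mult.commute)
        moreover have "(LINT x|N. (Y i x - Y j x)\<^sup>2) = sy i i + sy j j - 2 * sy j i"
          using gauss_familyD(3,6)[OF Y] ij
          by (subst integral_square_diff) (auto simp: sy_def power2_eq_square mult.commute)
        ultimately show "0 \<le> d i i + d j j - 2 * d i j" using le[OF ij] by (simp add: d_def)
      qed (auto simp: p_bnd p_sum)
      \<comment> \<open>Here the range from \<open>0\<close> to \<open>pi / 2\<close> enters: both
        sine and cosine are non-negative on it.\<close>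
      then have "0 \<le> (sin t * cos t * \<beta>) * (\<Sum>i\<in>J. \<Sum>j\<in>J. d i j * (p i (\<lambda>j. Z t j z) * of_bool (i = j) - p i (\<lambda>j. Z t j z) * p j (\<lambda>j. Z t j z)))"
        using t \<beta> by (intro mult_nonneg_nonneg sin_ge_zero cos_ge_zero) auto
      also have "\<dots> = (\<Sum>i\<in>J. \<Sum>j\<in>J. c t i j * D i j (\<lambda>j. Z t j z))"
        by (simp add: sum_distrib_left c_def d_def D_def mult_ac)
      finally show "0 \<le> (\<Sum>i\<in>J. \<Sum>j\<in>J. c t i j * D i j (\<lambda>j. Z t j z))" .
    qed
    finally show ?thesis .
  qed
  have "\<phi> 0 \<le> \<phi> (pi / 2)"
  proof (rule DERIV_nonneg_imp_nondecreasing[of 0 "pi / 2" \<phi>])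
    show "\<exists>y. (\<phi> has_real_derivative y) (at t) \<and> 0 \<le> y" if "0 \<le> t" "t \<le> pi / 2" for t
      using d\<phi>[of t] \<phi>'_nonneg[OF that] by blast
  qed simp
  moreover have "\<phi> 0 = (LINT x|M. log_sum_exp J m \<beta> (\<lambda>j. X j x))"
  proof -
    have "(\<lambda>x. log_sum_exp J m \<beta> (\<lambda>j. X j x)) \<in> borel_measurable M" unfolding log_sum_exp_def by measurable
    from intM(2)[OF this] show ?thesis by (simp add: \<phi>_def Z_def)
  qed
  moreover have "\<phi> (pi / 2) = (LINT x|N. log_sum_exp J m \<beta> (\<lambda>j. Y j x))"
  proof -
    have "(\<lambda>x. log_sum_exp J m \<beta> (\<lambda>j. Y j x)) \<in> borel_measurable N" unfolding log_sum_exp_def by measurable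
    from intN(2)[OF this] show ?thesis by (simp add: \<phi>_def Z_def)
  qed
  ultimately show ?thesis by simp
qed

lemma gauss_family_integrable_Max:
  fixes Z :: "'i \<Rightarrow> 'c \<Rightarrow> real"
  assumes J: "finite J" "J \<noteq> {}" and Z: "gauss_family Q J Z" and \<beta>: "\<beta> > 0"
  shows "integrable Q (\<lambda>x. Max ((\<lambda>j. Z j x + m j) ` J))"
    and "integrable Q (\<lambda>x. log_sum_exp J m \<beta> (\<lambda>j. Z j x))"
proof -
  interpret prob_space Q using Z by (rule gauss_familyD)
  note [measurable] = gauss_familyD(2)[OF Z]
  \<comment> \<open>The factor 2 serves the lower bound of the maximum, which lies below
    \<open>log_sum_exp\<close> by up to one further term
    \<open>ln (real (card J)) / \<beta>\<close>.\<close>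
  define w where "w x = (\<Sum>k\<in>J. \<bar>Z k x\<bar> + \<bar>m k\<bar>) + 2 * (ln (real (card J)) / \<beta>)" for x
  have w: "integrable Q w" unfolding w_def using gauss_familyD(7)[OF Z] by auto
  have l: "0 \<le> ln (real (card J)) / \<beta>" using J \<beta> by (simp add: Suc_le_eq card_gt_0_iff)
  have "\<bar>log_sum_exp J m \<beta> (\<lambda>j. Z j x)\<bar> \<le> w x" "\<bar>Max ((\<lambda>j. Z j x + m j) ` J)\<bar> \<le> w x" for x
    using abs_log_sum_exp_le[OF J \<beta>, of m "\<lambda>j. Z j x"] l
      Max_le_log_sum_exp[OF J \<beta>, of "\<lambda>j. Z j x" m] log_sum_exp_le_Max[OF J \<beta>, of m "\<lambda>j. Z j x"]
    unfolding w_def by linarith+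
  then have "AE x in Q. norm (log_sum_exp J m \<beta> (\<lambda>j. Z j x)) \<le> norm (w x)" "AE x in Q. norm (Max ((\<lambda>j. Z j x + m j) ` J)) \<le> norm (w x)"
    by (auto intro!: AE_I2 order.trans[OF _ abs_ge_self])
  then show "integrable Q (\<lambda>x. Max ((\<lambda>j. Z j x + m j) ` J))"
    and "integrable Q (\<lambda>x. log_sum_exp J m \<beta> (\<lambda>j. Z j x))"
    by (auto intro!: Bochner_Integration.integrable_bound[OF w] borel_measurable_Max J simp: log_sum_exp_def)
qed

text \<open>Smoothing costs nothing on the left, where \<open>Max\<close> lies below
  \<open>log_sum_exp\<close>, and at most \<open>ln (real (card J)) / \<beta>\<close> on the right.
  This error vanishes as \<open>\<beta>\<close> runs through the positive integers.\<close>

theorem sudakov_fernique: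
  fixes X :: "'i \<Rightarrow> 'a \<Rightarrow> real" and Y :: "'i \<Rightarrow> 'b \<Rightarrow> real"
  assumes J: "finite J" "J \<noteq> {}"
    and X: "gauss_family M J X" and Y: "gauss_family N J Y"
    and le: "\<And>i j. i \<in> J \<Longrightarrow> j \<in> J \<Longrightarrow> (LINT x|M. (X i x - X j x)\<^sup>2) \<le> (LINT y|N. (Y i y - Y j y)\<^sup>2)"
  shows "(LINT x|M. Max ((\<lambda>j. X j x + m j) ` J)) \<le> (LINT y|N. Max ((\<lambda>j. Y j y + m j) ` J))"
proof -
  have "(LINT x|M. Max ((\<lambda>j. X j x + m j) ` J)) \<le> (LINT y|N. Max ((\<lambda>j. Y j y + m j) ` J)) + ln (real (card J)) / \<beta>"
    if \<beta>: "\<beta> > 0" for \<beta>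
  proof -
    interpret M: prob_space M using X by (rule gauss_familyD)
    interpret N: prob_space N using Y by (rule gauss_familyD)
    note m = gauss_family_integrable_Max[OF J X \<beta>] and n = gauss_family_integrable_Max[OF J Y \<beta>]
    have "(LINT x|M. Max ((\<lambda>j. X j x + m j) ` J)) \<le> (LINT x|M. log_sum_exp J m \<beta> (\<lambda>j. X j x))"
      using m Max_le_log_sum_exp[OF J \<beta>] by (intro integral_mono) auto
    also have "\<dots> \<le> (LINT y|N. log_sum_exp J m \<beta> (\<lambda>j. Y j y))"
      by (rule expectation_log_sum_exp_mono[OF J \<beta> X Y le])
    also have "\<dots> \<le> (LINT y|N. Max ((\<lambda>j. Y j y + m j) ` J) + ln (real (card J)) / \<beta>)"
      using n log_sum_exp_le_Max[OF J \<beta>] by (intro integral_mono) auto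
    also have "\<dots> = (LINT y|N. Max ((\<lambda>j. Y j y + m j) ` J)) + ln (real (card J)) / \<beta>"
      using n by (simp add: N.prob_space)
    finally show ?thesis .
  qed
  note bound = this
  have "(\<lambda>n. (LINT y|N. Max ((\<lambda>j. Y j y + m j) ` J)) + ln (real (card J)) / real (Suc n)) \<longlonglongrightarrow>
      (LINT y|N. Max ((\<lambda>j. Y j y + m j) ` J)) + 0"
    by (intro tendsto_intros LIMSEQ_Suc lim_const_over_n)
  then show ?thesis
    using bound[of "real (Suc n)" for n] by (intro LIMSEQ_le_const[of _ _ "LINT x|M. Max ((\<lambda>j. X j x + m j) ` J)"]) auto
qed

section \<open>Increments of bifractional Brownian motion\<close>

text \<open>Bernoulli's inequality for exponents at most 1: weighted arithmetic-geometric means of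
  \<open>1 + x\<close> and \<open>1\<close>.\<close>

lemma powr_le_one_plus_mult:
  fixes a x :: real
  assumes "0 \<le> a" "a \<le> 1" "-1 \<le> x"
  shows "(1 + x) powr a \<le> 1 + a * x"
proof (cases "x = -1")
  case True
  then show ?thesis using assms by simp
next
  case False
  then have x: "1 + x > 0" using assms by simp
  have "(1 + x) powr a * 1 powr (1 - a) \<le> a * (1 + x) + (1 - a) * 1"
    using x assms by (intro Youngs_inequality_0) auto
  then show ?thesis by (simp add: algebra_simps)
qed

text \<open>After division by \<open>a + b\<close> the two fractions add up to 1, and each is at
  most its own power with exponent \<open>K \<le> 1\<close>.\<close>

lemma powr_add_le_subadditive:
  fixes a b K :: real
  assumes "0 \<le> a" "0 \<le> b" "0 < K" "K \<le> 1"
  shows "(a + b) powr K \<le> a powr K + b powr K"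
proof (cases "a + b = 0")
  case True
  then show ?thesis using assms by simp
next
  case False
  then have s: "a + b > 0" using assms by simp
  have *: "u / (a + b) \<le> (u / (a + b)) powr K" if "0 \<le> u" "u \<le> a + b" for u
    using powr_mono'[of K 1 "u / (a + b)"] that assms s by simp
  have "1 = a / (a + b) + b / (a + b)" using s by (simp add: add_divide_distrib[symmetric])
  also have "\<dots> \<le> (a / (a + b)) powr K + (b / (a + b)) powr K"
    using assms by (intro add_mono *) auto
  also have "\<dots> = (a powr K + b powr K) / (a + b) powr K"
    using assms s by (simp add: powr_divide add_divide_distrib)
  finally show ?thesis using s by (simp add: field_simps)
qed

text \<open>Hoelder continuity with constant 1. It is applied with exponent \<open>H\<close>, to
  compare \<open>t powr H - s powr H\<close> with \<open>\<bar>s - t\<bar> powr H\<close>.\<close>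

lemma powr_diff_ge_abs:
  fixes a b K :: real
  assumes "0 \<le> a" "0 \<le> b" "0 < K" "K \<le> 1"
  shows "\<bar>a powr K - b powr K\<bar> \<le> \<bar>a - b\<bar> powr K"
proof -
  have *: "x powr K - y powr K \<le> (x - y) powr K" if "0 \<le> y" "y \<le> x" for x y
    using powr_add_le_subadditive[of "x - y" y K] that assms by simp
  show ?thesis
  proof (cases "b \<le> a")
    case True
    then show ?thesis using *[of b a] powr_mono2[of K b a] assms by simp
  next
    case False
    then show ?thesis using *[of a b] powr_mono2[of K a b] assms by (simp add: abs_if)
  qed
qed

text \<open>The first two summands are bounded below using \<open>(1 + x) powr (1 - K) \<le> 1 + (1 - K) x\<close>,
  which loses nothing at \<open>x = 0\<close>, and the third one by the same estimate at \<open>- s\<close>.\<close>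

lemma sum_three_powr_ge_two:
  fixes c s K :: real
  assumes "0 < K" "K \<le> 1" "c\<^sup>2 + s\<^sup>2 = 1" "0 \<le> c" "0 \<le> s"
  shows "2 \<le> (1 + c) powr K + (1 - c) powr K + (1 - s) powr K"
proof -
  define L where "L = 1 - K"
  have L: "0 \<le> L" "L < 1" using assms by (auto simp: L_def)
  have "c\<^sup>2 \<le> 1" "s\<^sup>2 \<le> 1" using assms(3) zero_le_power2[of c] zero_le_power2[of s] by linarith+
  then have c1: "c \<le> 1" and s1: "s \<le> 1"
    using power2_le_imp_le[of c 1] power2_le_imp_le[of s 1] by simp_all
  have b: "(1 + x) / (1 + L * x) \<le> (1 + x) powr K" if "-1 \<le> x" "x \<le> 1" for x
  proof (cases "x = -1")
    case False
    then have x: "1 + x > 0" using that by simp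
    have "L * x \<ge> - L" using mult_left_mono[of "-1" x L] that L by simp
    then have p: "1 + L * x > 0" using L by linarith
    have "(1 + x) = (1 + x) powr K * (1 + x) powr L"
      using x by (simp add: L_def powr_add[symmetric])
    also have "\<dots> \<le> (1 + x) powr K * (1 + L * x)"
      using L that by (intro mult_left_mono powr_le_one_plus_mult) auto
    finally show ?thesis using p by (simp add: field_simps)
  qed simp
  have Lc: "L * c < 1" using L c1 assms mult_mono[of L L c 1] by simp
  then have Lc': "1 + L * c > 0" "1 - L * c > 0" using L assms by (auto intro: add_pos_nonneg)
  have d: "1 - L\<^sup>2 * c\<^sup>2 = (1 + L * c) * (1 - L * c)" by (simp add: power2_eq_square algebra_simps)
  have dpos: "1 - L\<^sup>2 * c\<^sup>2 > 0" unfolding d using Lc' by simp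
  have c2: "c\<^sup>2 \<le> 1" using assms(3) by (smt (verit) zero_le_power2)
  \<comment> \<open>The amount \<open>(1 + L) / 2 * c\<^sup>2\<close> is what the first two summands
    may lose from 2 and what the third one must repay. Its coefficient is the value of
    \<open>(1 + L * s) / (1 + s)\<close> at \<open>s = 1\<close>, the minimum on the unit interval.
    After clearing denominators the difference of the two sides is an explicit non-negative
    polynomial.\<close>
  have "(2 - (1 + L) / 2 * c\<^sup>2) * (1 - L\<^sup>2 * c\<^sup>2) \<le> 2 * (1 - L * c\<^sup>2)"
  proof -
    have "0 \<le> c\<^sup>2 * ((1 - L) ^ 3 / 2 + (1 + L) * L\<^sup>2 / 2 * (1 - c\<^sup>2))"
      using L c2 by (intro mult_nonneg_nonneg add_nonneg_nonneg) auto
    also have "\<dots> = 2 * (1 - L * c\<^sup>2) - (2 - (1 + L) / 2 * c\<^sup>2) * (1 - L\<^sup>2 * c\<^sup>2)"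
      by (simp add: field_simps power2_eq_square power3_eq_cube)
    finally show ?thesis by simp
  qed
  then have "2 - (1 + L) / 2 * c\<^sup>2 \<le> 2 * (1 - L * c\<^sup>2) / (1 - L\<^sup>2 * c\<^sup>2)"
    using dpos by (simp add: pos_le_divide_eq)
  also have "\<dots> = (1 + c) / (1 + L * c) + (1 - c) / (1 - L * c)"
    unfolding d using Lc' by (simp add: field_simps power2_eq_square)
  also have "\<dots> \<le> (1 + c) powr K + (1 - c) powr K"
    using b[of c] b[of "- c"] assms c1 by (intro add_mono) auto
  finally have 1: "2 - (1 + L) / 2 * c\<^sup>2 \<le> (1 + c) powr K + (1 - c) powr K" .
  have Ls: "L * s < 1" using L s1 assms mult_mono[of L L s 1] by simp
  have "(1 + L) / 2 * c\<^sup>2 = (1 + L) / 2 * ((1 - s) * (1 + s))"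
  proof -
    have "c\<^sup>2 = (1 - s) * (1 + s)" using assms(3) by (simp add: power2_eq_square algebra_simps)
    then show ?thesis by simp
  qed
  also have "\<dots> = (1 - s) * ((1 + L) / 2 * (1 + s))" by (simp add: algebra_simps)
  also have "\<dots> \<le> (1 - s) * (1 + L * s)"
  proof (rule mult_left_mono)
    have "0 \<le> (1 - L) * (1 - s)" using L s1 by simp
    then show "(1 + L) / 2 * (1 + s) \<le> 1 + L * s" by (simp add: field_simps)
  qed (use s1 in simp)
  also have "\<dots> \<le> (1 - s) * (1 / (1 - L * s))"
  proof (rule mult_left_mono)
    have "(1 + L * s) * (1 - L * s) \<le> 1"
      using zero_le_power2[of "L * s"] by (simp add: algebra_simps power2_eq_square)
    then show "1 + L * s \<le> 1 / (1 - L * s)" using Ls by (simp add: pos_le_divide_eq)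
  qed (use s1 in simp)
  also have "\<dots> \<le> (1 - s) powr K" using b[of "- s"] assms s1 by simp
  finally show ?thesis using 1 by simp
qed

text \<open>Bounds the concavity gap of the power \<open>K\<close> at a midpoint. Dividing by the
  mean \<open>q\<close> of the squares turns the bases on the right into \<open>1 + c\<close>,
  \<open>1 - c\<close> and \<open>1 - s\<close>, where \<open>c\<close> and \<open>s\<close> are the
  rational parametrisation of the unit circle by \<open>u\<close> and \<open>v\<close>. By symmetry
  \<open>v \<le> u\<close> may be assumed, so that \<open>c\<close> is non-negative.\<close>

lemma powr_mean_square_gap:
  fixes u v K :: real
  assumes "0 < K" "K \<le> 1" "0 \<le> u" "0 \<le> v"
  shows "2 * ((u\<^sup>2 + v\<^sup>2) / 2) powr K \<le> (u\<^sup>2) powr K + (v\<^sup>2) powr K + ((u - v)\<^sup>2 / 2) powr K"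
proof -
  have *: "2 * ((u\<^sup>2 + v\<^sup>2) / 2) powr K \<le> (u\<^sup>2) powr K + (v\<^sup>2) powr K + ((u - v)\<^sup>2 / 2) powr K" if uv: "0 \<le> v" "v \<le> u" "0 < u" for u v :: real
  proof -
    define q where "q = (u\<^sup>2 + v\<^sup>2) / 2"
    have q: "q > 0" using uv by (simp add: q_def add_pos_nonneg)
    define c where "c = (u\<^sup>2 - v\<^sup>2) / 2 / q"
    define s where "s = u * v / q"
    have e: "u\<^sup>2 = q * (1 + c)" "v\<^sup>2 = q * (1 - c)" "(u - v)\<^sup>2 / 2 = q * (1 - s)"
      using q unfolding c_def s_def by (simp_all add: field_simps) (simp_all add: q_def power2_eq_square field_simps)
    have "(u\<^sup>2 - v\<^sup>2)\<^sup>2 / 4 + (u * v)\<^sup>2 = q\<^sup>2"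
      unfolding q_def by (simp add: power2_eq_square field_simps)
    then have cs: "c\<^sup>2 + s\<^sup>2 = 1"
      unfolding c_def s_def using q by (simp add: field_simps power2_eq_square)
    have c0: "0 \<le> c" "0 \<le> s" unfolding c_def s_def using q uv by (auto intro!: divide_nonneg_pos power_mono)
    have "c\<^sup>2 \<le> 1" "s\<^sup>2 \<le> 1" using cs zero_le_power2[of c] zero_le_power2[of s] by linarith+
    then have "c \<le> 1" "s \<le> 1"
      using power2_le_imp_le[of c 1] power2_le_imp_le[of s 1] by simp_all
    then have "(u\<^sup>2) powr K + (v\<^sup>2) powr K + ((u - v)\<^sup>2 / 2) powr K =
        q powr K * ((1 + c) powr K + (1 - c) powr K + (1 - s) powr K)"
      unfolding e powr_mult by (simp only: distrib_left)
    also have "\<dots> \<ge> q powr K * 2"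
      using sum_three_powr_ge_two[OF assms(1,2) cs c0] by (intro mult_left_mono) auto
    finally show ?thesis unfolding q_def by simp
  qed
  consider "u = 0" "v = 0" | "v \<le> u" "0 < u" | "u \<le> v" "0 < v" using assms by linarith
  then show ?thesis
  proof cases
    case 1
    then show ?thesis by simp
  next
    case 2
    then show ?thesis using * assms by simp
  next
    case 3
    then show ?thesis using *[of u v] assms by (simp add: add_ac power2_commute)
  qed
qed

text \<open>Relative to the mean \<open>q\<close> the two points are \<open>1 + x\<close> and
  \<open>1 - x\<close>, and the linear terms of the two Bernoulli bounds cancel.\<close>

lemma powr_midpoint_ge:
  fixes a b K :: real
  assumes "0 < K" "K \<le> 1" "0 \<le> a" "0 \<le> b"
  shows "a powr K + b powr K \<le> 2 * ((a + b) / 2) powr K"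
proof (cases "a + b = 0")
  case True
  then have "a = 0" "b = 0" using assms by auto
  then show ?thesis using assms by simp
next
  case False
  define q where "q = (a + b) / 2"
  define x where "x = (a - b) / 2 / q"
  have q: "q > 0" using False assms by (simp add: q_def)
  have e: "a = q * (1 + x)" "b = q * (1 + - x)"
  proof -
    have "q * x = (a - b) / 2" using q by (simp add: x_def)
    then show "a = q * (1 + x)" "b = q * (1 + - x)"
      unfolding distrib_left by (simp_all add: q_def field_simps)
  qed
  have x: "-1 \<le> x" "x \<le> 1" 
  proof -
    have "0 \<le> q * (1 + x)" "0 \<le> q * (1 + - x)" using assms(3,4) e by metis+
    then have "0 \<le> 1 + x" "0 \<le> 1 + - x" using q by (auto simp: zero_le_mult_iff)
    then show "-1 \<le> x" "x \<le> 1" by simp_all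
  qed
  have "a powr K + b powr K = q powr K * ((1 + x) powr K + (1 + - x) powr K)"
    using e by (metis powr_mult distrib_left)
  also have "\<dots> \<le> q powr K * ((1 + K * x) + (1 + K * - x))"
    using assms x by (intro mult_left_mono add_mono powr_le_one_plus_mult) auto
  also have "\<dots> = 2 * ((a + b) / 2) powr K" by (simp add: q_def)
  finally show ?thesis .
qed

text \<open>By \<open>CC\<close> the increment variance is the concavity defect of the power
  \<open>K\<close> at \<open>a\<close> and \<open>b\<close>, plus \<open>2 powr (1 - K) * d\<close>.
  The defect is non-positive, which gives the upper bound. It is at least
  \<open>- (2 powr (- K) * d)\<close>, minus half of the other term, which leaves the lower
  constant.\<close>

lemma bifractional_increment_bounds:
  fixes H K s t :: real
  assumes "0 < H" "H < 1" "0 < K" "K \<le> 1" "0 \<le> s" "0 \<le> t"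
  defines "C \<equiv> \<lambda>s t. 1 / 2 powr K * ((t powr (2 * H) + s powr (2 * H)) powr K - \<bar>s - t\<bar> powr (2 * H * K))"
  shows "2 powr (- K) * \<bar>s - t\<bar> powr (2 * H * K) \<le> C s s + C t t - 2 * C s t" (is "?lower")
    and "C s s + C t t - 2 * C s t \<le> 2 powr (1 - K) * \<bar>s - t\<bar> powr (2 * H * K)" (is "?upper")
proof -
  define a where "a = t powr (2 * H)"
  define b where "b = s powr (2 * H)"
  define d where "d = \<bar>s - t\<bar> powr (2 * H * K)"
  have ab: "0 \<le> a" "0 \<le> b" by (auto simp: a_def b_def)
  have k: "2 powr (1 - K) = 2 / 2 powr K" "2 powr (- K) = 1 / 2 powr K"
    using powr_diff[of 2 1 K] powr_minus_divide[of 2 K] by simp_all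
  have diag: "C x x = (x powr (2 * H)) powr K" if "0 \<le> x" for x
  proof -
    have "x powr (2 * H) + x powr (2 * H) = 2 * x powr (2 * H)" by simp
    then show ?thesis by (simp only: C_def powr_mult) simp
  qed
  have "C s t = (a + b) powr K / 2 powr K - d / 2 powr K"
    unfolding C_def a_def b_def d_def by (simp add: diff_divide_distrib)
  then have CC: "C s s + C t t - 2 * C s t = a powr K + b powr K - 2 * ((a + b) / 2) powr K + 2 powr (1 - K) * d"
    using assms(5,6) by (simp add: diag a_def b_def k powr_divide)
  show ?upper
    unfolding CC d_def[symmetric] using powr_midpoint_ge[OF assms(3,4) ab] by simp
  \<comment> \<open>Square roots of \<open>a\<close> and \<open>b\<close>: the gap estimate is in
    terms of \<open>(u - v)\<^sup>2 / 2\<close>, and Hoelder continuity of the power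
    \<open>H\<close> bounds \<open>(u - v)\<^sup>2\<close> by
    \<open>\<bar>s - t\<bar> powr (2 * H)\<close>. The divisor 2 becomes the factor
    \<open>2 powr (- K)\<close>.\<close>
  define u where "u = t powr H"
  define v where "v = s powr H"
  have uv: "0 \<le> u" "0 \<le> v" "u\<^sup>2 = a" "v\<^sup>2 = b"
    using assms(5,6) by (auto simp: u_def v_def a_def b_def power2_eq_square simp flip: powr_add)
  have "(u - v)\<^sup>2 \<le> (\<bar>s - t\<bar> powr H)\<^sup>2"
    using powr_diff_ge_abs[of t s H] assms(1-6) 
    by (intro abs_le_square_iff[THEN iffD1]) (simp add: u_def v_def abs_minus_commute)
  also have "\<dots> = \<bar>s - t\<bar> powr (2 * H)" by (cases "s = t") (auto simp: power2_eq_square simp flip: powr_add)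
  finally have "((u - v)\<^sup>2 / 2) powr K \<le> (\<bar>s - t\<bar> powr (2 * H) / 2) powr K"
    using assms(3) by (intro powr_mono2) auto
  also have "\<dots> = 2 powr (- K) * d" by (simp add: powr_divide d_def powr_powr k)
  finally have "((u - v)\<^sup>2 / 2) powr K \<le> 2 powr (- K) * d" .
  with powr_mean_square_gap[OF assms(3,4) uv(1,2)]
  have "2 * ((a + b) / 2) powr K \<le> a powr K + b powr K + 2 powr (- K) * d" unfolding uv by simp
  moreover have "2 powr (1 - K) * d = 2 * (2 powr (- K) * d)" by (simp add: k)
  ultimately show ?lower unfolding CC d_def[symmetric] by linarith
qed

section \<open>Stop-loss order\<close>

lemma scaleR_interpolate: "(1 - k) *\<^sub>R a + k *\<^sub>R (a + l) = a + k * l" for a k l :: real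
  by (simp add: algebra_simps)

text \<open>Both \<open>a + h\<close> and \<open>b\<close> lie on the segment from \<open>a\<close>
  to \<open>b + h\<close>, and their weights at the right end, \<open>h / l\<close> and
  \<open>(b - a) / l\<close>, add up to 1. Summing the two chord bounds gives the claim.\<close>

lemma convex_on_increment_mono:
  fixes g :: "real \<Rightarrow> real"
  assumes g: "convex_on UNIV g" and "a \<le> b" "0 \<le> h"
  shows "g (a + h) - g a \<le> g (b + h) - g b"
proof (cases "h = 0 \<or> a = b")
  case False
  then have h: "0 < h" "a < b" using assms by auto
  define l where "l = b + h - a"
  have l: "l > 0" using h by (simp add: l_def)
  have comb: "(1 - u / l) * g a + u / l * g (b + h) \<ge> g (a + u)" if "0 \<le> u" "u \<le> l" for u
  proof -
    have "g ((1 - u / l) *\<^sub>R a + (u / l) *\<^sub>R (b + h)) \<le> (1 - u / l) * g a + u / l * g (b + h)"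
      using that l by (intro convex_onD[OF g]) auto
    moreover have "(1 - u / l) *\<^sub>R a + (u / l) *\<^sub>R (b + h) = a + u / l * l"
      using scaleR_interpolate[of "u / l" a l] by (simp only: l_def) (simp add: add.commute)
    ultimately show ?thesis using l by simp
  qed
  have "g (a + h) + g (a + (b - a)) \<le> (1 - h / l) * g a + h / l * g (b + h) + ((1 - (b - a) / l) * g a + (b - a) / l * g (b + h))"
    using h by (intro add_mono comb) (auto simp: l_def)
  also have "\<dots> = (2 - (h / l + (b - a) / l)) * g a + (h / l + (b - a) / l) * g (b + h)"
    by (simp add: algebra_simps)
  also have "h / l + (b - a) / l = 1"
    using l by (simp add: add_divide_distrib[symmetric]) (simp add: l_def)
  finally show ?thesis by simp
qed auto

text \<open>Since \<open>c\<close> is a convex combination of \<open>c - h\<close> and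
  \<open>x\<close>, the chord over the interval from \<open>c - h\<close> to \<open>c\<close>,
  prolonged to the right, stays below \<open>g\<close>. The chord slope replaces a one-sided
  derivative.\<close>

lemma convex_on_slope_le:
  fixes g :: "real \<Rightarrow> real"
  assumes g: "convex_on UNIV g" and "0 < h" "c \<le> x"
  shows "(g c - g (c - h)) / h * (x - c) \<le> g x - g c"
proof (cases "x = c")
  case False
  define u where "u = x - c"
  have u: "u > 0" using False assms by (simp add: u_def)
  have "g ((1 - h / (u + h)) *\<^sub>R (c - h) + (h / (u + h)) *\<^sub>R x) \<le> (1 - h / (u + h)) * g (c - h) + h / (u + h) * g x"
    using u assms by (intro convex_onD[OF g]) auto
  moreover have "(1 - h / (u + h)) *\<^sub>R (c - h) + (h / (u + h)) *\<^sub>R x = c - h + h / (u + h) * (u + h)"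
    using scaleR_interpolate[of "h / (u + h)" "c - h" "u + h"] by (simp add: u_def)
  moreover have "h / (u + h) * (u + h) = h" using u assms by simp
  moreover have "1 - h / (u + h) = u / (u + h)" using u assms by (simp add: field_simps)
  ultimately have "g c \<le> u / (u + h) * g (c - h) + h / (u + h) * g x" by simp
  also have "\<dots> = (u * g (c - h) + h * g x) / (u + h)" by (simp add: add_divide_distrib)
  finally have "g c * (u + h) \<le> u * g (c - h) + h * g x"
    using u assms by (simp add: pos_le_divide_eq)
  then show ?thesis using assms by (simp add: u_def[symmetric] field_simps)
qed simp

text \<open>Every piece of the interpolation below has the slope of the preceding chord of \<open>g\<close>, so it
  stays below \<open>g\<close>; this spares an integrability assumption on a shift of \<open>g\<close>.\<close>

lemma convex_stop_loss_approx:
  fixes g :: "real \<Rightarrow> real"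
  assumes mono: "mono g" and g: "convex_on UNIV g" and h: "0 < h"
  obtains w c :: "nat \<Rightarrow> real" where "\<And>k. 0 \<le> w k"
    and "\<And>n x. L \<le> x \<Longrightarrow> g L + (\<Sum>k\<le>n. w k * max (x - c k) 0) \<le> g x"
    and "\<And>n x. L \<le> x \<Longrightarrow> x \<le> L + real n * h \<Longrightarrow> g (x - 2 * h) \<le> g L + (\<Sum>k\<le>n. w k * max (x - c k) 0)"
proof
  define c where "c k = L + real k * h" for k :: nat
  define d where "d k = (g (c k) - g (c k - h)) / h" for k
  \<comment> \<open>The jump of the slope at each knot. The initial slope \<open>d 0\<close> is
    non-negative by monotonicity of \<open>g\<close>, the later jumps by convexity.\<close>
  define w where "w k = (if k = 0 then d 0 else d k - d (k - 1))" for k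
  have c_Suc: "c (Suc k) = c k + h" for k by (simp add: c_def algebra_simps)
  have c_mono: "c k \<le> c l" if "k \<le> l" for k l using that h by (simp add: c_def mult_right_mono)
  show w: "0 \<le> w k" for k
  proof (cases k)
    case 0
    then show ?thesis using h monoD[OF mono, of "c 0 - h" "c 0"] by (simp add: w_def d_def)
  next
    case (Suc l)
    have "g (c l - h + h) - g (c l - h) \<le> g (c l + h) - g (c l)"
      using convex_on_increment_mono[OF g, of "c l - h" "c l" h] h by simp
    then show ?thesis using h by (simp add: Suc w_def d_def c_Suc divide_right_mono flip: diff_divide_distrib)
  qed
  define P where "P n x = g L + (\<Sum>k\<le>n. w k * max (x - c k) 0)" for n x
  have P_Suc: "P (Suc n) x = P n x + w (Suc n) * max (x - c (Suc n)) 0" for n x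
    by (simp add: P_def)
  have dh: "d k * h = g (c k) - g (c k - h)" for k using h by (simp add: d_def)
  \<comment> \<open>Past the knot \<open>c n\<close> the interpolation is affine with slope
    \<open>d n\<close>. At the knot its value is that of \<open>g\<close> one mesh earlier, plus the
    constant \<open>g L - g (L - h)\<close> which makes it start at \<open>g L\<close>.\<close>
  have P_eq: "P n x = d n * (x - c n) + g (c n - h) + (g L - g (L - h))" if "c n \<le> x" for n x
    using that
  proof (induction n)
    case 0
    then show ?case by (simp add: P_def w_def c_def)
  next
    case (Suc n)
    have "c n \<le> x" using Suc.prems h by (simp add: c_Suc)
    then have "P (Suc n) x = d n * (x - c n) + g (c n - h) + (g L - g (L - h)) + (d (Suc n) - d n) * (x - c (Suc n))"
      using Suc by (simp add: P_Suc w_def)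
    also have "\<dots> = d (Suc n) * (x - c (Suc n)) + d n * h + g (c n - h) + (g L - g (L - h))"
      by (simp add: c_Suc algebra_simps)
    finally show ?case using dh[of n] by (simp add: c_Suc)
  qed
  have upper: "P n x \<le> g x" if "L \<le> x" for n x
  proof (induction n)
    case 0
    have "c 0 \<le> x" using that by (simp add: c_def)
    then show ?case using P_eq[of 0 x] convex_on_slope_le[OF g h, of "c 0" x] by (simp add: d_def c_def)
  next
    case (Suc n)
    show ?case
    proof (cases "c (Suc n) \<le> x")
      case True
      \<comment> \<open>The starting constant is the increment of \<open>g\<close> over the mesh
        ending at \<open>L\<close>. By convexity it is at most the increment over the mesh ending at
        the present knot, so the interpolation does not exceed \<open>g\<close> there.\<close>
      have "g (L - h + h) - g (L - h) \<le> g (c (Suc n) - h + h) - g (c (Suc n) - h)"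
        using c_mono[of 0 "Suc n"] h by (intro convex_on_increment_mono[OF g]) (auto simp: c_def)
      then show ?thesis
        using P_eq[OF True] convex_on_slope_le[OF g h True] by (simp add: d_def)
    next
      case False
      then show ?thesis using Suc by (simp add: P_Suc)
    qed
  qed
  then show "g L + (\<Sum>k\<le>n. w k * max (x - c k) 0) \<le> g x" if "L \<le> x" for n x
    using that by (simp add: P_def)
  have lower: "g (x - 2 * h) \<le> P n x" if "L \<le> x" "x \<le> L + real n * h" for n x
    using that
  proof (induction n)
    case 0
    then have "x = L" by simp
    then show ?case using h monoD[OF mono, of "L - 2 * h" L] by (simp add: P_def c_def)
  next
    case (Suc n)
    show ?case
    proof (cases "x \<le> L + real n * h")
      case True
      then show ?thesis using Suc w[of "Suc n"] by (simp add: P_Suc add_increasing2)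
    next
      case False
      then have cn: "c n \<le> x" by (simp add: c_def)
      \<comment> \<open>One mesh accounts for rounding \<open>x\<close> down to a knot, the other
        for the lag of the interpolation at that knot.\<close>
      have "x - 2 * h \<le> c n - h" using Suc.prems by (simp add: c_def algebra_simps)
      then have "g (x - 2 * h) \<le> g (c n - h)" by (rule monoD[OF mono])
      also have "\<dots> \<le> P n x"
      proof -
        have "0 \<le> d n" using h monoD[OF mono, of "c n - h" "c n"] by (simp add: d_def)
        moreover have "g (L - h) \<le> g L" using h by (intro monoD[OF mono]) simp
        ultimately show ?thesis using P_eq[OF cn] cn by simp
      qed
      also have "\<dots> \<le> P (Suc n) x" using w[of "Suc n"] by (simp add: P_Suc)
      finally show ?thesis .
    qed
  qed
  then show "g (x - 2 * h) \<le> g L + (\<Sum>k\<le>n. w k * max (x - c k) 0)" if "L \<le> x" "x \<le> L + real n * h" for n x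
    using that by (simp add: P_def)
qed

text \<open>Stop-loss order implies increasing convex order. The approximants are \<open>g L\<close>
  plus non-negative combinations of stop-loss functions, hence are compared term by term. They lie
  between \<open>g L\<close> and \<open>g\<close>, so integrability of \<open>g (U x)\<close> and
  \<open>g (V y)\<close> yields dominated convergence.\<close>

lemma expectation_convex_mono:
  fixes g :: "real \<Rightarrow> real" and U :: "'a \<Rightarrow> real" and V :: "'b \<Rightarrow> real"
  assumes M: "prob_space M" and N: "prob_space N"
    and mono: "mono g" and g: "convex_on UNIV g"
    and U: "integrable M U" "\<And>x. L \<le> U x" "integrable M (\<lambda>x. g (U x))"
    and V: "integrable N V" "\<And>y. L \<le> V y" "integrable N (\<lambda>y. g (V y))"
    and le: "\<And>c. (LINT x|M. max (U x) c) \<le> (LINT y|N. max (V y) c)"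
  shows "(LINT x|M. g (U x)) \<le> (LINT y|N. g (V y))"
proof -
  interpret M: prob_space M by fact
  interpret N: prob_space N by fact
  have gc: "isCont g x" for x
    using convex_on_continuous[OF open_UNIV g] by (simp add: continuous_on_eq_continuous_at)
  have [measurable]: "g \<in> borel_measurable borel"
    using gc by (intro borel_measurable_continuous_onI continuous_at_imp_continuous_on) auto
  have [measurable]: "U \<in> borel_measurable M" "V \<in> borel_measurable N" using U V by auto
  define h where "h n = 1 / real (Suc n)" for n
  have h: "h n > 0" for n by (simp add: h_def)
  define Q where "Q n w c \<longleftrightarrow> (\<forall>k. 0 \<le> w k) \<and>
    (\<forall>m x. L \<le> x \<longrightarrow> g L + (\<Sum>k\<le>m. w k * max (x - c k) 0) \<le> g x) \<and>
    (\<forall>m x. L \<le> x \<longrightarrow> x \<le> L + real m * h n \<longrightarrow> g (x - 2 * h n) \<le> g L + (\<Sum>k\<le>m. w k * max (x - c k) 0))"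
    for n and w c :: "nat \<Rightarrow> real"
  have "\<exists>w c. Q n w c" for n
    unfolding Q_def by (rule convex_stop_loss_approx[OF mono g h[of n], of L]) blast
  then obtain w c where "\<And>n. Q n (w n) (c n)" by metis
  then have w: "\<And>n k. 0 \<le> w n k"
    and up: "\<And>n m x. L \<le> x \<Longrightarrow> g L + (\<Sum>k\<le>m. w n k * max (x - c n k) 0) \<le> g x"
    and lo: "\<And>n m x. L \<le> x \<Longrightarrow> x \<le> L + real m * h n \<Longrightarrow> g (x - 2 * h n) \<le> g L + (\<Sum>k\<le>m. w n k * max (x - c n k) 0)"
    unfolding Q_def by blast+
  \<comment> \<open>With mesh \<open>1 / real (Suc n)\<close> this many knots reach up to
    \<open>L + real (Suc n)\<close>, so that every point is eventually covered while the mesh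
    shrinks.\<close>
  define K where "K n = Suc n * Suc n" for n
  define G where "G n x = g L + (\<Sum>k\<le>K n. w n k * max (x - c n k) 0)" for n x
  have G_up: "G n x \<le> g x" if "L \<le> x" for n x using up[OF that] by (simp only: G_def)
  have G_lo: "g L \<le> G n x" for n x unfolding G_def using w by (auto intro!: sum_nonneg)
  have [measurable]: "G n \<in> borel_measurable borel" for n unfolding G_def by measurable
  have lim: "(\<lambda>n. G n x) \<longlonglongrightarrow> g x" if x: "L \<le> x" for x
  proof (rule tendsto_sandwich)
    show "\<forall>\<^sub>F n in sequentially. g (x - 2 * h n) \<le> G n x"
    proof -
      obtain N where N: "x - L \<le> real N" using real_arch_simple by blast
      have "g (x - 2 * h n) \<le> G n x" if "N \<le> n" for n
      proof -
        have "real (K n) * h n = real (Suc n)"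
          by (simp only: h_def K_def of_nat_mult) simp
        then have "x \<le> L + real (K n) * h n" using N that by simp
        then show ?thesis using lo[OF x] unfolding G_def by blast
      qed
      then show ?thesis by (auto simp: eventually_sequentially)
    qed
    show "\<forall>\<^sub>F n in sequentially. G n x \<le> g x" using G_up[OF x] by simp
    have "(\<lambda>n. x - 2 * h n) \<longlonglongrightarrow> x - 2 * 0"
      unfolding h_def by (intro tendsto_intros LIMSEQ_Suc lim_const_over_n)
    then show "(\<lambda>n. g (x - 2 * h n)) \<longlonglongrightarrow> g x"
      using isCont_tendsto_compose[OF gc, of "\<lambda>n. x - 2 * h n" x] by simp
  qed simp
  have limM: "(\<lambda>n. LINT x|M. G n (U x)) \<longlonglongrightarrow> (LINT x|M. g (U x))"
  proof (rule integral_dominated_convergence[where w = "\<lambda>x. \<bar>g L\<bar> + \<bar>g (U x)\<bar>"])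
    have "norm (G n (U x)) \<le> \<bar>g L\<bar> + \<bar>g (U x)\<bar>" for n x
      using G_lo[of n "U x"] G_up[OF U(2), of n x] by auto
    then show "AE x in M. norm (G n (U x)) \<le> \<bar>g L\<bar> + \<bar>g (U x)\<bar>" for n by simp
  qed (use U lim in auto)
  have limN: "(\<lambda>n. LINT x|N. G n (V x)) \<longlonglongrightarrow> (LINT x|N. g (V x))"
  proof (rule integral_dominated_convergence[where w = "\<lambda>x. \<bar>g L\<bar> + \<bar>g (V x)\<bar>"])
    have "norm (G n (V x)) \<le> \<bar>g L\<bar> + \<bar>g (V x)\<bar>" for n x
      using G_lo[of n "V x"] G_up[OF V(2), of n x] by auto
    then show "AE x in N. norm (G n (V x)) \<le> \<bar>g L\<bar> + \<bar>g (V x)\<bar>" for n by simp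
  qed (use V lim in auto)
  have max_eq: "max (x - c) 0 = max x c - c" for x c :: real by simp
  have "(LINT x|M. G n (U x)) \<le> (LINT x|N. G n (V x))" for n
  proof -
    have "(LINT x|M. G n (U x)) = g L + (\<Sum>k\<le>K n. w n k * ((LINT x|M. max (U x) (c n k)) - c n k))"
      unfolding G_def max_eq using U(1) by (simp add: M.prob_space)
    also have "\<dots> \<le> g L + (\<Sum>k\<le>K n. w n k * ((LINT x|N. max (V x) (c n k)) - c n k))"
      using w le by (intro add_left_mono sum_mono mult_left_mono diff_right_mono) auto
    also have "\<dots> = (LINT x|N. G n (V x))"
      unfolding G_def max_eq using V(1) by (simp add: N.prob_space)
    finally show ?thesis .
  qed
  then show ?thesis using limM limN by (intro LIMSEQ_le[of _ _ "\<lambda>n. LINT x|N. G n (V x)"]) auto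
qed

section \<open>Suprema of Gaussian processes\<close>

text \<open>In both alternatives of \<open>gaussian_rv\<close> the vanishing mean forces
  \<open>\<mu> = 0\<close>, and the point mass obeys the normal formula with variance zero.\<close>

lemma gaussian_rv_centered:
  assumes P: "prob_space M" and S: "gaussian_rv M S" and mean: "(LINT x|M. S x) = 0"
  shows "integrable M (\<lambda>x. (S x)\<^sup>2)"
    and "(CLINT x|M. iexp (S x)) = complex_of_real (exp (- (LINT x|M. (S x)\<^sup>2) / 2))"
proof -
  interpret prob_space M by fact
  have [measurable]: "S \<in> borel_measurable M" using S by (simp add: gaussian_rv_def)
  have "integrable M (\<lambda>x. (S x)\<^sup>2) \<and>
    (CLINT x|M. iexp (S x)) = complex_of_real (exp (- (LINT x|M. (S x)\<^sup>2) / 2))"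
  proof (cases "\<exists>\<mu>. AE x in M. S x = \<mu>")
    case True
    then obtain \<mu> where \<mu>: "AE x in M. S x = \<mu>" by blast
    have "(LINT x|M. S x) = (LINT x|M. \<mu>)" using \<mu> by (intro integral_cong_AE) auto
    then have "\<mu> = 0" using mean by (simp add: prob_space)
    then have 0: "AE x in M. S x = 0" using \<mu> by simp
    have "(CLINT x|M. iexp (S x)) = (CLINT x|M. 1)" using 0 by (intro integral_cong_AE) auto
    moreover have "(LINT x|M. (S x)\<^sup>2) = (LINT x|M. 0)" using 0 by (intro integral_cong_AE) auto
    moreover have "integrable M (\<lambda>x. (S x)\<^sup>2)"
      using 0 by (subst integrable_cong_AE[of _ _ "\<lambda>_. 0"]) auto
    ultimately show ?thesis by (simp add: prob_space)
  next
    case False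
    then obtain \<mu> \<sigma> where \<sigma>: "0 < \<sigma>" and D: "distributed M lborel S (normal_density \<mu> \<sigma>)"
      using S by (auto simp: gaussian_rv_def)
    have "\<mu> = 0" using normal_distributed_expectation[OF \<sigma> D] mean by simp
    with D have D: "distributed M lborel S (normal_density 0 \<sigma>)" by simp
    have "integrable M (\<lambda>x. (S x)\<^sup>2)"
      using integrable_normal_moment[OF \<sigma>, of 0 2] by (subst distributed_integrable[OF D, symmetric]) auto
    moreover have "(LINT x|M. (S x)\<^sup>2) = \<sigma>\<^sup>2"
      using normal_distributed_variance[OF \<sigma> D] mean by simp
    moreover have "(CLINT x|M. iexp (S x)) = complex_of_real (exp (- (\<sigma>\<^sup>2 * 1\<^sup>2) / 2))"
      using normal_distributed_char[OF D \<sigma>, of 1] by simp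
    ultimately show ?thesis by simp
  qed
  then show "integrable M (\<lambda>x. (S x)\<^sup>2)"
    and "(CLINT x|M. iexp (S x)) = complex_of_real (exp (- (LINT x|M. (S x)\<^sup>2) / 2))" by auto
qed

lemma centered_gaussian_process_gauss_family:
  assumes X: "centered_gaussian_process M I C X"
  shows "gauss_family M I X" and "\<And>s t. s \<in> I \<Longrightarrow> t \<in> I \<Longrightarrow> (LINT x|M. X s x * X t x) = C s t"
proof -
  have P: "prob_space M" and meas: "\<And>t. t \<in> I \<Longrightarrow> X t \<in> borel_measurable M"
    and lin: "\<And>J a. finite J \<Longrightarrow> J \<subseteq> I \<Longrightarrow> gaussian_rv M (\<lambda>\<omega>. \<Sum>t\<in>J. a t * X t \<omega>)"
    and mean: "\<And>t. t \<in> I \<Longrightarrow> (LINT x|M. X t x) = 0"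
    and cov: "\<And>s t. s \<in> I \<Longrightarrow> t \<in> I \<Longrightarrow> covariance M (X s) (X t) = C s t"
    using X unfolding centered_gaussian_process_def gaussian_process_def by auto
  interpret prob_space M by fact
  have sq: "integrable M (\<lambda>x. (X t x)\<^sup>2)" if "t \<in> I" for t
    using gaussian_rv_centered(1)[OF P lin[of "{t}" "\<lambda>_. 1"]] that mean by simp
  have int: "integrable M (X t)" if "t \<in> I" for t
    using integrable_square_mult[of "X t" M "\<lambda>_. 1"] meas sq that by simp
  have "(CLINT x|M. iexp (\<Sum>t\<in>J. b t * X t x)) =
       complex_of_real (exp (- (LINT x|M. (\<Sum>t\<in>J. b t * X t x)\<^sup>2) / 2))" if "finite J" "J \<subseteq> I" for J b
  proof (rule gaussian_rv_centered(2)[OF P lin[OF that]])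
    have "(LINT x|M. (\<Sum>t\<in>J. b t * X t x)) = (\<Sum>t\<in>J. b t * (LINT x|M. X t x))"
      using that int by (subst Bochner_Integration.integral_sum) auto
    then show "(LINT x|M. (\<Sum>t\<in>J. b t * X t x)) = 0" using mean that by (simp add: subset_iff)
  qed
  then show "gauss_family M I X" unfolding gauss_family_def using P meas sq mean by blast
  show "(LINT x|M. X s x * X t x) = C s t" if "s \<in> I" "t \<in> I" for s t
    using cov[OF that] mean that by (simp add: covariance_def)
qed

lemma gauss_family_scale:
  assumes X: "gauss_family M I X" and Y: "\<And>t x. t \<in> I \<Longrightarrow> Y t x = a * X t x"
  shows "gauss_family M I Y"
  unfolding gauss_family_def
proof (intro conjI ballI allI impI)
  show "prob_space M" using X by (rule gauss_familyD)
  fix t assume t: "t \<in> I"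
  have e: "Y t = (\<lambda>x. a * X t x)" using Y[OF t] by auto
  show "Y t \<in> borel_measurable M" "integrable M (\<lambda>x. (Y t x)\<^sup>2)" "(LINT x|M. Y t x) = 0"
    unfolding e using gauss_familyD(2-4)[OF X t] by (auto simp: power_mult_distrib)
next
  fix J b assume J: "finite J" "J \<subseteq> I"
  have "(\<Sum>t\<in>J. b t * Y t x) = (\<Sum>t\<in>J. (b t * a) * X t x)" for x
    using J Y by (intro sum.cong) auto
  then show "(CLINT x|M. iexp (\<Sum>t\<in>J. b t * Y t x)) =
       complex_of_real (exp (- (LINT x|M. (\<Sum>t\<in>J. b t * Y t x)\<^sup>2) / 2))"
    using gauss_familyD(5)[OF X J, of "\<lambda>t. b t * a"] by (simp only:)
qed

text \<open>The entry at \<open>t = s\<close> is the constant \<open>m s\<close>, a common lower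
  bound of both maxima from which the stop-loss approximation can start. As \<open>X s\<close> and
  \<open>Y s\<close> have mean zero, subtracting them leaves expectations unchanged, and each
  stop-loss comparison becomes one of plain maxima with a modified drift.\<close>

lemma sudakov_fernique_convex:
  fixes X :: "'i \<Rightarrow> 'a \<Rightarrow> real" and Y :: "'i \<Rightarrow> 'b \<Rightarrow> real" and g :: "real \<Rightarrow> real"
  assumes J: "finite J" and s: "s \<in> J"
    and X: "gauss_family M J X" and Y: "gauss_family N J Y"
    and le: "\<And>i j. i \<in> J \<Longrightarrow> j \<in> J \<Longrightarrow> (LINT x|M. (X i x - X j x)\<^sup>2) \<le> (LINT y|N. (Y i y - Y j y)\<^sup>2)"
    and g: "mono g" "convex_on UNIV g"
    and iX: "integrable M (\<lambda>x. g (Max ((\<lambda>t. X t x + m t - X s x) ` J)))"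
    and iY: "integrable N (\<lambda>x. g (Max ((\<lambda>t. Y t x + m t - Y s x) ` J)))"
  shows "(LINT x|M. g (Max ((\<lambda>t. X t x + m t - X s x) ` J))) \<le> (LINT x|N. g (Max ((\<lambda>t. Y t x + m t - Y s x) ` J)))"
proof (rule expectation_convex_mono[OF _ _ g _ _ iX _ _ iY])
  have ne: "J \<noteq> {}" using s by auto
  show "prob_space M" "prob_space N" using X Y by (auto dest: gauss_familyD)
  have lower: "m s \<le> Max ((\<lambda>t. Z t + m t - Z s) ` J)" for Z :: "'i \<Rightarrow> real"
    using J s by (intro Max_ge) (auto intro: image_eqI[of _ _ s])
  show "m s \<le> Max ((\<lambda>t. X t x + m t - X s x) ` J)" for x by (rule lower)
  show "m s \<le> Max ((\<lambda>t. Y t x + m t - Y s x) ` J)" for x by (rule lower)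
  have shift: "Max ((\<lambda>t. Z t + m t - Z s) ` J) = Max ((\<lambda>t. Z t + m t) ` J) - Z s" for Z m :: "'i \<Rightarrow> real"
    using mono_Max_commute[of "\<lambda>x. x - Z s" "(\<lambda>t. Z t + m t) ` J"] J ne by (simp add: image_image mono_def)
  show "integrable M (\<lambda>x. Max ((\<lambda>t. X t x + m t - X s x) ` J))"
    unfolding shift[of "\<lambda>t. X t x" for x]
    using gauss_family_integrable_Max(1)[OF J ne X, of 1] gauss_familyD(7)[OF X s] by auto
  show "integrable N (\<lambda>x. Max ((\<lambda>t. Y t x + m t - Y s x) ` J))"
    unfolding shift[of "\<lambda>t. Y t x" for x]
    using gauss_family_integrable_Max(1)[OF J ne Y, of 1] gauss_familyD(7)[OF Y s] by auto
  fix c :: real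
  text \<open>Truncation at \<open>c\<close> only changes the drift at \<open>s\<close>.\<close>
  define m' where "m' t = (if t = s then max (m s) c else m t)" for t
  have trunc: "max (Max ((\<lambda>t. Z t + m t - Z s) ` J)) c = Max ((\<lambda>t. Z t + m' t) ` J) - Z s" for Z :: "'i \<Rightarrow> real"
  proof -
    have "max (Max ((\<lambda>t. Z t + m t - Z s) ` J)) c = Max ((\<lambda>t. Z t + m' t - Z s) ` J)"
    proof (rule antisym)
      have "Z t + m t - Z s \<le> Max ((\<lambda>t. Z t + m' t - Z s) ` J)" if "t \<in> J" for t
      proof -
        have "Z t + m t - Z s \<le> Z t + m' t - Z s" by (simp add: m'_def)
        also have "\<dots> \<le> Max ((\<lambda>t. Z t + m' t - Z s) ` J)" using J that by (auto intro!: Max_ge)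
        finally show ?thesis .
      qed
      moreover have "c \<le> Max ((\<lambda>t. Z t + m' t - Z s) ` J)"
      proof -
        have "c \<le> Z s + m' s - Z s" by (simp add: m'_def)
        also have "\<dots> \<le> Max ((\<lambda>t. Z t + m' t - Z s) ` J)"
          using J s by (intro Max_ge) (auto intro: image_eqI[of _ _ s])
        finally show ?thesis .
      qed
      ultimately show "max (Max ((\<lambda>t. Z t + m t - Z s) ` J)) c \<le> Max ((\<lambda>t. Z t + m' t - Z s) ` J)"
        using J ne by simp
      have "Z t + m' t - Z s \<le> max (Max ((\<lambda>t. Z t + m t - Z s) ` J)) c" if "t \<in> J" for t
      proof -
        have "Z t + m t - Z s \<le> Max ((\<lambda>t. Z t + m t - Z s) ` J)" using J that by (intro Max_ge) auto
        then show ?thesis by (auto simp: m'_def)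
      qed
      then show "Max ((\<lambda>t. Z t + m' t - Z s) ` J) \<le> max (Max ((\<lambda>t. Z t + m t - Z s) ` J)) c"
        using J ne by (simp del: max.bounded_iff)
    qed
    then show ?thesis by (simp add: shift)
  qed
  have "(LINT x|M. max (Max ((\<lambda>t. X t x + m t - X s x) ` J)) c) = (LINT x|M. Max ((\<lambda>t. X t x + m' t) ` J))"
    unfolding trunc[of "\<lambda>t. X t x" for x]
    using gauss_family_integrable_Max(1)[OF J ne X, of 1 m'] gauss_familyD(4,7)[OF X s] by simp
  also have "\<dots> \<le> (LINT x|N. Max ((\<lambda>t. Y t x + m' t) ` J))"
    by (rule sudakov_fernique[OF J ne X Y le])
  also have "\<dots> = (LINT x|N. max (Max ((\<lambda>t. Y t x + m t - Y s x) ` J)) c)"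
    unfolding trunc[of "\<lambda>t. Y t x" for x]
    using gauss_family_integrable_Max(1)[OF J ne Y, of 1 m'] gauss_familyD(4,7)[OF Y s] by simp
  finally show "(LINT x|M. max (Max ((\<lambda>t. X t x + m t - X s x) ` J)) c) \<le> (LINT x|N. max (Max ((\<lambda>t. Y t x + m t - Y s x) ` J)) c)" .
qed

section \<open>From finite grids to the interval\<close>

text \<open>The reference time \<open>s\<close> belongs to every grid, as the finite comparison
  requires of its index set. The remaining points enumerate the rationals of the interval.\<close>

definition dense_grid :: "real \<Rightarrow> real \<Rightarrow> nat \<Rightarrow> real set" where
  "dense_grid T s n = insert s (from_nat_into (\<rat> \<inter> {0..T}) ` {..n})"

lemma dense_grid:
  assumes T: "0 < T" and s: "s \<in> {0..T}"
  shows "finite (dense_grid T s n)" "s \<in> dense_grid T s n" "dense_grid T s n \<subseteq> {0..T}"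
proof -
  have "\<rat> \<inter> {0..T} \<noteq> {}" using T by auto
  then have "from_nat_into (\<rat> \<inter> {0..T}) k \<in> {0..T}" for k using from_nat_into[of "\<rat> \<inter> {0..T}" k] by auto
  then show "dense_grid T s n \<subseteq> {0..T}" using s unfolding dense_grid_def by auto
qed (auto simp: dense_grid_def)

lemma Max_dense_grid:
  fixes f :: "real \<Rightarrow> real"
  assumes T: "0 < T" and s: "s \<in> {0..T}" and f: "continuous_on {0..T} f"
  shows "(\<lambda>n. Max (f ` dense_grid T s n)) \<longlonglongrightarrow> (SUP t\<in>{0..T}. f t)"
    and "f s \<le> Max (f ` dense_grid T s n)" "Max (f ` dense_grid T s n) \<le> (SUP t\<in>{0..T}. f t)"
proof -
  note grid = dense_grid[OF T s]
  have "bdd_above (f ` {0..T})"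
    using compact_continuous_image[OF f] compact_Icc by (intro bounded_imp_bdd_above compact_imp_bounded) auto
  then have le_SUP: "f t \<le> (SUP t\<in>{0..T}. f t)" if "t \<in> {0..T}" for t
    using that by (intro cSUP_upper)
  show upper: "Max (f ` dense_grid T s n) \<le> (SUP t\<in>{0..T}. f t)" for n
  proof -
    have "f t \<le> (SUP t\<in>{0..T}. f t)" if "t \<in> dense_grid T s n" for t
      using le_SUP subsetD[OF grid(3) that] by blast
    then show ?thesis using grid(1,2)[of n] by (subst Max_le_iff) auto
  qed
  show "f s \<le> Max (f ` dense_grid T s n)" using grid by (intro Max_ge) auto
  obtain t where t: "t \<in> {0..T}" "\<And>u. u \<in> {0..T} \<Longrightarrow> f u \<le> f t"
    using continuous_attains_sup[of "{0..T}" f] f T by auto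
  have St: "(SUP t\<in>{0..T}. f t) = f t"
    using t T by (intro cSup_eq_maximum) auto
  show "(\<lambda>n. Max (f ` dense_grid T s n)) \<longlonglongrightarrow> (SUP t\<in>{0..T}. f t)"
  proof (rule LIMSEQ_I)
    fix e :: real assume e: "0 < e"
    obtain d where d: "d > 0" "\<And>u. u \<in> {0..T} \<Longrightarrow> \<bar>u - t\<bar> < d \<Longrightarrow> \<bar>f u - f t\<bar> < e"
      using f t(1) e unfolding continuous_on_iff dist_real_def by blast
    \<comment> \<open>The rational must stay inside the interval: the maximum point is approached
      from the right, except at \<open>T\<close>, where it is approached from the left.\<close>
    have "\<exists>q\<in>\<rat> \<inter> {0..T}. \<bar>q - t\<bar> < d"
    proof (cases "t < T")
      case True
      then obtain q where "q \<in> \<rat>" "t < q" "q < min T (t + d)"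
        using Rats_dense_in_real[of t "min T (t + d)"] d by auto
      then show ?thesis using t by (intro bexI[of _ q]) auto
    next
      case False
      then have "t = T" using t by simp
      moreover obtain q where "q \<in> \<rat>" "max 0 (T - d) < q" "q < T"
        using Rats_dense_in_real[of "max 0 (T - d)" T] d T by auto
      ultimately show ?thesis by (intro bexI[of _ q]) auto
    qed
    then obtain q where q: "q \<in> \<rat> \<inter> {0..T}" "\<bar>q - t\<bar> < d" by blast
    have "countable (\<rat> \<inter> {0..T})" by (intro countable_Int1 countable_rat)
    then obtain k where k: "q = from_nat_into (\<rat> \<inter> {0..T}) k"
      using q(1) by (metis from_nat_into_surj)
    have "norm (Max (f ` dense_grid T s n) - (SUP t\<in>{0..T}. f t)) < e" if "k \<le> n" for n
    proof -
      have "q \<in> dense_grid T s n" using that k by (auto simp: dense_grid_def)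
      then have "f q \<le> Max (f ` dense_grid T s n)" using grid by (intro Max_ge) auto
      moreover have "f t - e < f q" using d(2)[of q] q by auto
      ultimately show ?thesis using upper[of n] St by simp
    qed
    then show "\<exists>k. \<forall>n\<ge>k. norm (Max (f ` dense_grid T s n) - (SUP t\<in>{0..T}. f t)) < e" by blast
  qed
qed

text \<open>Almost surely the transformed grid maxima lie between the constant
  \<open>g (m s)\<close> and \<open>g (S x)\<close>, the latter integrable by hypothesis, so
  dominated convergence applies on the completion. Grid maxima are measurable for \<open>M\<close>
  itself, and their integrals can be moved back to the original space.\<close>

lemma expectation_grid_limit:
  fixes X :: "real \<Rightarrow> 'a \<Rightarrow> real" and g :: "real \<Rightarrow> real"
  assumes T: "0 < T" and s: "s \<in> {0..T}" and X: "gauss_family M {0..T} X"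
    and cX: "continuous_paths M {0..T} X" and m: "continuous_on {0..T} m"
    and g: "mono g" "\<And>x. isCont g x"
    and S: "AE x in M. S x = (SUP t\<in>{0..T}. X t x + m t - X s x)"
    and iS: "integrable (completion M) (\<lambda>x. g (S x))"
  defines "U \<equiv> \<lambda>n x. g (Max ((\<lambda>t. X t x + m t - X s x) ` dense_grid T s n))"
  shows "integrable M (U n)" and "(\<lambda>n. LINT x|M. U n x) \<longlonglongrightarrow> (LINT x|completion M. g (S x))"
proof -
  interpret prob_space M using X by (rule gauss_familyD)
  note grid = dense_grid[OF T s]
  have [measurable]: "g \<in> borel_measurable borel"
    using g by (intro borel_measurable_continuous_onI continuous_at_imp_continuous_on) auto
  have Xm: "X t \<in> borel_measurable M" if "t \<in> {0..T}" for t using gauss_familyD(2)[OF X that] .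
  have "(\<lambda>x. X t x + m t - X s x) \<in> borel_measurable M" if "t \<in> dense_grid T s n" for t n
    using Xm[OF subsetD[OF grid(3) that]] Xm[OF s] by measurable
  then have "(\<lambda>x. Max ((\<lambda>t. X t x + m t - X s x) ` dense_grid T s n)) \<in> borel_measurable M" for n
    using grid(1) by (intro borel_measurable_Max) auto
  then have Um[measurable]: "U n \<in> borel_measurable M" for n unfolding U_def by measurable
  have Uc[measurable]: "U n \<in> borel_measurable (completion M)" for n by (rule measurable_completion) simp
  have ae: "AE x in M. (\<lambda>n. U n x) \<longlonglongrightarrow> g (S x) \<and> (\<forall>n. g (m s) \<le> U n x \<and> U n x \<le> g (S x))"
    using S cX[unfolded continuous_paths_def]
  proof eventually_elim
    case (elim x)
    have c: "continuous_on {0..T} (\<lambda>t. X t x + m t - X s x)"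
      using elim(2) m by (intro continuous_intros) auto
    note lim = Max_dense_grid[OF T s c]
    have "(\<lambda>n. U n x) \<longlonglongrightarrow> g (S x)"
      unfolding U_def elim(1) by (rule isCont_tendsto_compose[OF g(2) lim(1)])
    moreover have "g (m s) \<le> U n x" "U n x \<le> g (S x)" for n
      unfolding U_def elim(1) using lim(2,3)[of n] by (auto intro!: monoD[OF g(1)])
    ultimately show ?case by blast
  qed
  note ae' = AE_completion[OF ae]
  have w: "integrable (completion M) (\<lambda>x. \<bar>g (m s)\<bar> + \<bar>g (S x)\<bar>)"
    using iS by (intro Bochner_Integration.integrable_add integrable_abs) (simp_all add: integrable_completion)
  have bnd: "AE x in completion M. norm (U n x) \<le> \<bar>g (m s)\<bar> + \<bar>g (S x)\<bar>" for n
    using ae'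
  proof eventually_elim
    case (elim x)
    then have "g (m s) \<le> U n x" "U n x \<le> g (S x)" by auto
    then show ?case by auto
  qed
  have "integrable (completion M) (U n)" for n
    by (rule Bochner_Integration.integrable_bound[OF w]) (use bnd[of n] in \<open>auto elim: eventually_mono\<close>)
  then show "integrable M (U n)" for n by (simp add: integrable_completion)
  have "(\<lambda>n. LINT x|completion M. U n x) \<longlonglongrightarrow> (LINT x|completion M. g (S x))"
    by (rule integral_dominated_convergence[OF _ _ w _ bnd])
       (use iS ae' in \<open>auto elim: eventually_mono\<close>)
  then show "(\<lambda>n. LINT x|M. U n x) \<longlonglongrightarrow> (LINT x|completion M. g (S x))"
    by (simp add: integral_completion)
qed

text \<open>The suprema enter only up to null sets, so the form without a subtracted value is an
  instance as well once the process vanishes almost surely at \<open>s\<close>.\<close>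

theorem gaussian_supremum_comparison:
  fixes X :: "real \<Rightarrow> 'a \<Rightarrow> real" and Y :: "real \<Rightarrow> 'b \<Rightarrow> real" and g :: "real \<Rightarrow> real"
  assumes T: "0 < T" and s: "s \<in> {0..T}"
    and X: "gauss_family M {0..T} X" "continuous_paths M {0..T} X"
    and Y: "gauss_family N {0..T} Y" "continuous_paths N {0..T} Y"
    and m: "continuous_on {0..T} m" and g: "mono g" "convex_on UNIV g"
    and le: "\<And>t u. t \<in> {0..T} \<Longrightarrow> u \<in> {0..T} \<Longrightarrow> (LINT x|M. (X t x - X u x)\<^sup>2) \<le> (LINT y|N. (Y t y - Y u y)\<^sup>2)"
    and SX: "AE x in M. SX x = (SUP t\<in>{0..T}. X t x + m t - X s x)" "expectation_exists M (\<lambda>x. g (SX x))"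
    and SY: "AE x in N. SY x = (SUP t\<in>{0..T}. Y t x + m t - Y s x)" "expectation_exists N (\<lambda>x. g (SY x))"
  shows "expect M (\<lambda>x. g (SX x)) \<le> expect N (\<lambda>x. g (SY x))"
proof -
  have gc: "isCont g x" for x
    using convex_on_continuous[OF open_UNIV g(2)] by (simp add: continuous_on_eq_continuous_at)
  note grid = dense_grid[OF T s]
  note limX = expectation_grid_limit[OF T s X m g(1) gc SX(1) SX(2)[unfolded expectation_exists_def]]
  note limY = expectation_grid_limit[OF T s Y m g(1) gc SY(1) SY(2)[unfolded expectation_exists_def]]
  have "(LINT x|M. g (Max ((\<lambda>t. X t x + m t - X s x) ` dense_grid T s n)))
      \<le> (LINT x|N. g (Max ((\<lambda>t. Y t x + m t - Y s x) ` dense_grid T s n)))" for n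
    using grid(3)[of n] by (intro sudakov_fernique_convex grid gauss_family_subset[OF X(1)] gauss_family_subset[OF Y(1)]
        le g limX limY) auto
  then show ?thesis
    unfolding expect_def by (intro LIMSEQ_le[OF limX(2) limY(2)]) auto
qed

section \<open>Application to bifractional and fractional Brownian motion\<close>

lemma gauss_family_AE_zero:
  assumes "gauss_family M I X" "t \<in> I" "(LINT x|M. X t x * X t x) = 0"
  shows "AE x in M. X t x = 0"
proof -
  have "(LINT x|M. (X t x)\<^sup>2) = 0" using assms(3) by (simp add: power2_eq_square)
  then have "AE x in M. (X t x)\<^sup>2 = 0"
    using gauss_familyD(3)[OF assms(1,2)] by (subst (asm) integral_nonneg_eq_0_iff_AE) auto
  then show ?thesis by simp
qed

lemma gauss_family_increment:
  assumes "gauss_family M I X" "s \<in> I" "t \<in> I"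
  shows "(LINT x|M. (X s x - X t x)\<^sup>2) =
    (LINT x|M. X s x * X s x) + (LINT x|M. X t x * X t x) - 2 * (LINT x|M. X s x * X t x)"
  using gauss_familyD(3,6)[OF assms(1)] assms(2,3)
  by (subst integral_square_diff) (auto simp: power2_eq_square)

lemma fractional_bm_increment:
  assumes B: "fractional_bm N h B" and st: "0 \<le> s" "0 \<le> t"
  shows "(LINT x|N. (B s x - B t x)\<^sup>2) = \<bar>s - t\<bar> powr (2 * h)"
proof -
  note G = centered_gaussian_process_gauss_family[OF conjunct2[OF conjunct2[OF B[unfolded fractional_bm_def]]]]
  show ?thesis
    using st by (simp add: gauss_family_increment[OF G(1)] G(2) abs_minus_commute diff_divide_distrib add_divide_distrib)
qed

lemma continuous_paths_scale:
  assumes "continuous_paths N S B" "\<And>t x. t \<in> S \<Longrightarrow> Y t x = a * B t x"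
  shows "continuous_paths N S Y"
  unfolding continuous_paths_def
  using assms(1)[unfolded continuous_paths_def]
proof eventually_elim
  case (elim x)
  then have "continuous_on S (\<lambda>t. a * B t x)" by (intro continuous_intros)
  then show ?case using assms(2) by (simp cong: continuous_on_cong)
qed

theorem theorem2p9:
  fixes M :: "'a measure" and N :: "'b measure"
    and H K T :: real
    and W :: "real \<Rightarrow> 'a \<Rightarrow> real"
    and B Y1 Y2 :: "real \<Rightarrow> 'b \<Rightarrow> real"
    and m :: "real \<Rightarrow> real"
  assumes "0 < H" "H < 1" "0 < K" "K \<le> 1" "0 < T"
    and "bifractional_bm M H K W" "continuous_paths M {0..T} W"
    and "fractional_bm N (H * K) B" "continuous_paths N {0..T} B"
    and "\<And>t \<omega>. t \<in> {0..T} \<Longrightarrow> Y1 t \<omega> = 2 powr ((1 - K) / 2) * B t \<omega>"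
    and "\<And>t \<omega>. t \<in> {0..T} \<Longrightarrow> Y2 t \<omega> = 2 powr (- K / 2) * B t \<omega>"
    and "continuous_on {0..T} m"
  shows
    "((expectation_exists M (\<lambda>\<omega>. SUP t\<in>{0..T}. W t \<omega> + m t) \<and>
       expectation_exists N (\<lambda>\<omega>. SUP t\<in>{0..T}. Y1 t \<omega> + m t) \<longrightarrow>
       expect M (\<lambda>\<omega>. SUP t\<in>{0..T}. W t \<omega> + m t)
       \<le> expect N (\<lambda>\<omega>. SUP t\<in>{0..T}. Y1 t \<omega> + m t)) \<and>
      (expectation_exists N (\<lambda>\<omega>. SUP t\<in>{0..T}. Y2 t \<omega> + m t) \<and>
       expectation_exists M (\<lambda>\<omega>. SUP t\<in>{0..T}. W t \<omega> + m t) \<longrightarrow>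
       expect N (\<lambda>\<omega>. SUP t\<in>{0..T}. Y2 t \<omega> + m t)
       \<le> expect M (\<lambda>\<omega>. SUP t\<in>{0..T}. W t \<omega> + m t))) \<and>
     (\<forall>c. \<forall>s\<in>{0..T}.
      (expectation_exists M (\<lambda>\<omega>. max (SUP t\<in>{0..T}. W t \<omega> + m t - W s \<omega>) c) \<and>
       expectation_exists N (\<lambda>\<omega>. max (SUP t\<in>{0..T}. Y1 t \<omega> + m t - Y1 s \<omega>) c) \<longrightarrow>
       expect M (\<lambda>\<omega>. max (SUP t\<in>{0..T}. W t \<omega> + m t - W s \<omega>) c)
       \<le> expect N (\<lambda>\<omega>. max (SUP t\<in>{0..T}. Y1 t \<omega> + m t - Y1 s \<omega>) c)) \<and>
      (expectation_exists N (\<lambda>\<omega>. max (SUP t\<in>{0..T}. Y2 t \<omega> + m t - Y2 s \<omega>) c) \<and>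
       expectation_exists M (\<lambda>\<omega>. max (SUP t\<in>{0..T}. W t \<omega> + m t - W s \<omega>) c) \<longrightarrow>
       expect N (\<lambda>\<omega>. max (SUP t\<in>{0..T}. Y2 t \<omega> + m t - Y2 s \<omega>) c)
       \<le> expect M (\<lambda>\<omega>. max (SUP t\<in>{0..T}. W t \<omega> + m t - W s \<omega>) c))) \<and>
     (\<forall>g :: real \<Rightarrow> real. mono g \<and> convex_on UNIV g \<longrightarrow> (\<forall>s\<in>{0..T}.
      (expectation_exists M (\<lambda>\<omega>. g (SUP t\<in>{0..T}. W t \<omega> + m t - W s \<omega>)) \<and>
       expectation_exists N (\<lambda>\<omega>. g (SUP t\<in>{0..T}. Y1 t \<omega> + m t - Y1 s \<omega>)) \<longrightarrow>
       expect M (\<lambda>\<omega>. g (SUP t\<in>{0..T}. W t \<omega> + m t - W s \<omega>))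
       \<le> expect N (\<lambda>\<omega>. g (SUP t\<in>{0..T}. Y1 t \<omega> + m t - Y1 s \<omega>))) \<and>
      (expectation_exists N (\<lambda>\<omega>. g (SUP t\<in>{0..T}. Y2 t \<omega> + m t - Y2 s \<omega>)) \<and>
       expectation_exists M (\<lambda>\<omega>. g (SUP t\<in>{0..T}. W t \<omega> + m t - W s \<omega>)) \<longrightarrow>
       expect N (\<lambda>\<omega>. g (SUP t\<in>{0..T}. Y2 t \<omega> + m t - Y2 s \<omega>))
       \<le> expect M (\<lambda>\<omega>. g (SUP t\<in>{0..T}. W t \<omega> + m t - W s \<omega>)))))"
proof -
  note H = \<open>0 < H\<close> \<open>H < 1\<close> and K = \<open>0 < K\<close> \<open>K \<le> 1\<close> and T = \<open>0 < T\<close>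
  note Y1 = assms(10) and Y2 = assms(11) and m = \<open>continuous_on {0..T} m\<close>
  note cW = \<open>continuous_paths M {0..T} W\<close> and cB = \<open>continuous_paths N {0..T} B\<close>
  define C where "C s t = 1 / 2 powr K * ((t powr (2 * H) + s powr (2 * H)) powr K - \<bar>s - t\<bar> powr (2 * H * K))" for s t
  have "centered_gaussian_process M {0..} C W"
    using \<open>bifractional_bm M H K W\<close> unfolding bifractional_bm_def C_def by blast
  note W0 = centered_gaussian_process_gauss_family[OF this]
  have "centered_gaussian_process N {0..}
       (\<lambda>s t. 1 / 2 * (t powr (2 * (H * K)) + s powr (2 * (H * K)) - \<bar>t - s\<bar> powr (2 * (H * K)))) B"
    using \<open>fractional_bm N (H * K) B\<close> unfolding fractional_bm_def by blast
  note B0 = centered_gaussian_process_gauss_family[OF this]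
  have GW: "gauss_family M {0..T} W" and GB: "gauss_family N {0..T} B"
    using gauss_family_subset[OF W0(1)] gauss_family_subset[OF B0(1)] by auto
  have G1: "gauss_family N {0..T} Y1" and G2: "gauss_family N {0..T} Y2"
    using gauss_family_scale[OF GB Y1] gauss_family_scale[OF GB Y2] by blast+
  have c1: "continuous_paths N {0..T} Y1" and c2: "continuous_paths N {0..T} Y2"
    using continuous_paths_scale[OF cB Y1] continuous_paths_scale[OF cB Y2] by blast+
  have incW: "(LINT x|M. (W s x - W t x)\<^sup>2) = C s s + C t t - 2 * C s t" if "s \<in> {0..T}" "t \<in> {0..T}" for s t
    using that by (simp add: gauss_family_increment[OF W0(1)] W0(2))
  have scaled: "(LINT x|N. (a * B s x - a * B t x)\<^sup>2) = a\<^sup>2 * \<bar>s - t\<bar> powr (2 * H * K)"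
    if "s \<in> {0..T}" "t \<in> {0..T}" for a s t
    using that fractional_bm_increment[OF \<open>fractional_bm N (H * K) B\<close>, of s t]
    by (simp add: power_mult_distrib mult.assoc flip: right_diff_distrib)
  \<comment> \<open>The squared scale factors of \<open>Y1\<close> and \<open>Y2\<close> are exactly
    the two constants of the increment bounds.\<close>
  have sq: "(2 powr ((1 - K) / 2))\<^sup>2 = 2 powr (1 - K)" "(2 powr (- K / 2))\<^sup>2 = 2 powr (- K)"
    by (simp_all add: power2_eq_square flip: powr_add)
  have le1: "(LINT x|M. (W s x - W t x)\<^sup>2) \<le> (LINT x|N. (Y1 s x - Y1 t x)\<^sup>2)"
    and le2: "(LINT x|N. (Y2 s x - Y2 t x)\<^sup>2) \<le> (LINT x|M. (W s x - W t x)\<^sup>2)"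
    if st: "s \<in> {0..T}" "t \<in> {0..T}" for s t
    using bifractional_increment_bounds[OF H K, of s t, folded C_def] st
    by (simp_all only: incW[OF st] Y1[OF st(1)] Y1[OF st(2)] Y2[OF st(1)] Y2[OF st(2)] scaled[OF st] sq atLeastAtMost_iff)
  have "C 0 0 = 0" using H K by (simp add: C_def)
  then have W_0: "AE x in M. W 0 x = 0"
    using gauss_family_AE_zero[OF W0(1), of 0] W0(2)[of 0 0] by simp
  have "AE x in N. B 0 x = 0"
    using gauss_family_AE_zero[OF B0(1), of 0] B0(2)[of 0 0] H K by simp
  then have Y_0: "AE x in N. Y1 0 x = 0" "AE x in N. Y2 0 x = 0" using Y1[of 0] Y2[of 0] T by simp_all
  \<comment> \<open>Both directions are the same comparison: \<open>W\<close> is the process with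
    smaller increments against \<open>Y1\<close> and the one with larger increments against
    \<open>Y2\<close>.\<close>
  note upper = gaussian_supremum_comparison[OF T _ GW cW G1 c1 m _ _ le1]
  note lower = gaussian_supremum_comparison[OF T _ G2 c2 GW cW m _ _ le2]
  \<comment> \<open>Truncation at \<open>c\<close> is itself non-decreasing and convex, so the
    inequalities with a constant are those for the choice \<open>g x = max x c\<close>.\<close>
  have max: "mono (\<lambda>x. max x c)" "convex_on UNIV (\<lambda>x. max x c)" for c :: real
  proof -
    show "mono (\<lambda>x. max x c)" by (auto simp: mono_def)
    show "convex_on UNIV (\<lambda>x. max x c)"
    proof (rule convex_onI)
      fix t x y :: real assume t: "0 < t" "t < 1"
      have "(1 - t) * c + t * c \<le> (1 - t) * max x c + t * max y c"
        using t by (intro add_mono mult_left_mono) auto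
      moreover have "(1 - t) * x + t * y \<le> (1 - t) * max x c + t * max y c"
        using t by (intro add_mono mult_left_mono) auto
      moreover have "(1 - t) * c + t * c = c" by (simp add: algebra_simps)
      ultimately show "max ((1 - t) *\<^sub>R x + t *\<^sub>R y) c \<le> (1 - t) * max x c + t * max y c"
        by (simp only: real_scaleR_def max.bounded_iff)
    qed simp
  qed
  \<comment> \<open>The value at time \<open>0\<close> vanishes only almost surely, so the two
    suprema agree off a null set. The plain inequalities then follow with \<open>s = 0\<close> and
    \<open>g\<close> the identity.\<close>
  have SW: "AE x in M. (SUP t\<in>{0..T}. W t x + m t) = (SUP t\<in>{0..T}. W t x + m t - W 0 x)"
    using W_0 by eventually_elim simp
  have S1: "AE x in N. (SUP t\<in>{0..T}. Y1 t x + m t) = (SUP t\<in>{0..T}. Y1 t x + m t - Y1 0 x)"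
    using Y_0(1) by eventually_elim simp
  have S2: "AE x in N. (SUP t\<in>{0..T}. Y2 t x + m t) = (SUP t\<in>{0..T}. Y2 t x + m t - Y2 0 x)"
    using Y_0(2) by eventually_elim simp
  have id: "mono (\<lambda>x::real. x)" "convex_on UNIV (\<lambda>x::real. x)" by (auto simp: mono_def convex_on_def)
  have zero: "0 \<in> {0..T}" using T by simp
  show ?thesis
    apply (intro conjI allI ballI impI; elim conjE)
    subgoal by (rule upper[OF zero id _ _ SW _ S1])
    subgoal by (rule lower[OF zero id _ _ S2 _ SW])
    subgoal for c s by (rule upper[OF _ max _ _ AE_I2 _ AE_I2, of s]) simp_all
    subgoal for c s by (rule lower[OF _ max _ _ AE_I2 _ AE_I2, of s]) simp_all
    subgoal for g s by (rule upper[OF _ _ _ _ _ AE_I2 _ AE_I2, of s g]) simp_all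
    subgoal for g s by (rule lower[OF _ _ _ _ _ AE_I2 _ AE_I2, of s g]) simp_all
    done
qed

end
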